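(* The maps $\mathrm{Homeo}(\mathbb R^2,\mathbf 0)\times\tilde{\mathcal M}\to\tilde{\mathcal M}$, $(H,P)\mapsto H(P)$, and $\mathrm{Homeo}(\mathbb R^2,\mathbf 0)\times\tilde{\mathcal E}\to\tilde{\mathcal E}$, $(H,(P,p))\mapsto H(P,p)$, are continuous, where $\mathrm{Homeo}(\mathbb R^2,\mathbf 0)$ carries the compact-open topology and $\tilde{\mathcal M},\tilde{\mathcal E}$ carry the immersive topologies.
   Context: Let $\Delta$ be the open oriented topological $2$-disk with basepoint $x_0$. A pointed local homeomorphism is an orientation-preserving local homeomorphism $\phi:\Delta\to\mathbb R^2$ with $\phi(x_0)=\mathbf 0$. Two such maps $\phi,\psi$ are isomorphic if $\psi=\phi\circ h^{-1}$ for some orientation-preserving homeomorphism $h$ of $\Delta$ fixing $x_0$. The moduli space $\tilde{\mathcal M}$ is the set of isomorphism classes $[\phi]$; an element $P\in\tilde{\mathcal M}$ is a planar surface, regarded as a topological open disk with basepoint $o_P$ and developing map $\mathrm{dev}_P:P\to\mathbb R^2$, an orientation-preserving local homeomorphism with $\mathrm{dev}_P(o_P)=\mathbf 0$. The set $\tilde{\mathcal E}$ is the set of classes $[\phi,y]$ of pairs ($\phi$ pointed local homeomorphism, $y\in\Delta$) under $(\phi,y)\sim(\phi\circ h^{-1},h(y))$, identified with pairs $(P,p)$, $P=[\phi]$, $p\in P$; $\tilde\pi(P,p)=P$. $\mathrm{Homeo}(\mathbb R^2,\mathbf 0)$ is the group of homeomorphisms of $\mathbb R^2$ fixing $\mathbf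 0$. For orientation-preserving $H$: $H([\phi])=[H\circ\phi]$ and $H([\phi,y])=[H\circ\phi,y]$. For orientation-reversing $H$: fix an orientation-reversing homeomorphism $j:\Delta\to\Delta$ with $j(x_0)=x_0$, and set $H([\phi])=[H\circ\phi\circ j^{-1}]$ and $H([\phi,y])=[H\circ\phi\circ j^{-1},j(y)]$ (independent of $j$). $\mathrm{PC}(P)$ is the set of path-connected subsets of $P$ containing $o_P$. For $A\in\mathrm{PC}(P)$, $B\in\mathrm{PC}(Q)$, an immersion $\iota:A\rightsquigarrow B$ is a continuous map with $\iota(o_P)=o_Q$ and $\mathrm{dev}_Q\circ\iota=\mathrm{dev}_P$ on $A$. An embedding is an injective immersion ($\hookrightarrow$). $\overline{\mathrm{Disk}}(P)$: elements of $\mathrm{PC}(P)$ homeomorphic to a closed $2$-disk with $o_P$ in their interior; $\mathrm{Disk}(P)$: elements of $\mathrm{PC}(P)$ homeomorphic to an open $2$-disk. The immersive topology on $\tilde{\mathcal M}$ is the coarsest topology in which $\{Q:K\rightsquigarrow Q\}$ is open for every $K\in\overline{\mathrm{Disk}}(P)$ and $\{Q:U\not\hookrightarrow Q\}$ is open for every $U\in\mathrm{Disk}(P)$, over all planar surfaces $P$. For compact $K\in\mathrm{PC}(P)$ and open $U\subset K^\circ$, $\tilde{\mathcal E}_+(K,U)=\{(Q,q):\exists\,\iota:K\rightsquigarrow Q,\ q\in\iota(U)\}$. The immersive topology on $\tilde{\mathcal E}$ is the coarsest topology making $\tilde\pi$ continuous and every $\tilde{\mathcal E}_+(K,U)$ open.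 *)

theory Defs
  imports "HOL-Analysis.Analysis"
begin

text \<open>Model: the open disk Delta is the complex plane (homeomorphic to an open disk) with its
standard orientation and basepoint 0; the target R^2 is also the complex plane, with origin 0.\<close>

definition circle_loop :: "complex \<Rightarrow> real \<Rightarrow> real \<Rightarrow> complex" where
  "circle_loop x r t = x + of_real r * exp (2 * of_real pi * \<i> * of_real t)"

definition local_homeo :: "(complex \<Rightarrow> complex) \<Rightarrow> bool" where
  "local_homeo f \<longleftrightarrow> continuous_on UNIV f \<and>
     (\<forall>x. \<exists>U. open U \<and> x \<in> U \<and> open (f ` U) \<and> (\<exists>g. homeomorphism U (f ` U) f g))"

text \<open>Orientation preserving at x: local degree +1, i.e. images of small positively oriented
circles around x are homotopic (as loops in the plane minus f x) to the positively oriented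
unit circle around f x.\<close>
definition orient_pres_at :: "(complex \<Rightarrow> complex) \<Rightarrow> complex \<Rightarrow> bool" where
  "orient_pres_at f x \<longleftrightarrow> (\<exists>e>0. \<forall>r. 0 < r \<and> r < e \<longrightarrow>
      homotopic_loops (- {f x}) (f \<circ> circle_loop x r) (circle_loop (f x) 1))"

definition orient_pres :: "(complex \<Rightarrow> complex) \<Rightarrow> bool" where
  "orient_pres f \<longleftrightarrow> (\<forall>x. orient_pres_at f x)"

definition pointed_lh :: "(complex \<Rightarrow> complex) \<Rightarrow> bool" where
  "pointed_lh \<phi> \<longleftrightarrow> local_homeo \<phi> \<and> orient_pres \<phi> \<and> \<phi> 0 = 0"

definition op_homeo0 :: "(complex \<Rightarrow> complex) \<Rightarrow> (complex \<Rightarrow> complex) \<Rightarrow> bool" where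
  "op_homeo0 h g \<longleftrightarrow> homeomorphism UNIV UNIV h g \<and> orient_pres h \<and> h 0 = 0"

definition Mclass :: "(complex \<Rightarrow> complex) \<Rightarrow> (complex \<Rightarrow> complex) set" where
  "Mclass \<phi> = {\<psi>. pointed_lh \<psi> \<and> (\<exists>h g. op_homeo0 h g \<and> \<psi> = \<phi> \<circ> g)}"

definition Ecl :: "(complex \<Rightarrow> complex) \<Rightarrow> complex \<Rightarrow> ((complex \<Rightarrow> complex) \<times> complex) set" where
  "Ecl \<phi> y = {(\<psi>, z). pointed_lh \<psi> \<and> (\<exists>h g. op_homeo0 h g \<and> \<psi> = \<phi> \<circ> g \<and> z = h y)}"

definition Mt :: "(complex \<Rightarrow> complex) set set" where
  "Mt = {Mclass \<phi> | \<phi>. pointed_lh \<phi>}"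

definition Et :: "((complex \<Rightarrow> complex) \<times> complex) set set" where
  "Et = {Ecl \<phi> y | \<phi> y. pointed_lh \<phi>}"

definition piE :: "((complex \<Rightarrow> complex) \<times> complex) set \<Rightarrow> (complex \<Rightarrow> complex) set" where
  "piE E = {\<psi>. \<exists>z. (\<psi>, z) \<in> E}"

definition PC :: "complex set \<Rightarrow> bool" where
  "PC A \<longleftrightarrow> path_connected A \<and> 0 \<in> A"

definition cdisk :: "complex set \<Rightarrow> bool" where
  "cdisk K \<longleftrightarrow> PC K \<and> K homeomorphic cball (0::complex) 1 \<and> 0 \<in> interior K"

definition odisk :: "complex set \<Rightarrow> bool" where
  "odisk U \<longleftrightarrow> PC U \<and> U homeomorphic ball (0::complex) 1"

text \<open>Immersion of A (in the surface with developing map phi) into the surface with developing map psi.\<close>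
definition immersion :: "(complex \<Rightarrow> complex) \<Rightarrow> complex set \<Rightarrow> (complex \<Rightarrow> complex) \<Rightarrow> (complex \<Rightarrow> complex) \<Rightarrow> bool" where
  "immersion \<phi> A \<psi> \<iota> \<longleftrightarrow> continuous_on A \<iota> \<and> \<iota> 0 = 0 \<and> (\<forall>a\<in>A. \<psi> (\<iota> a) = \<phi> a)"

definition embedding :: "(complex \<Rightarrow> complex) \<Rightarrow> complex set \<Rightarrow> (complex \<Rightarrow> complex) \<Rightarrow> (complex \<Rightarrow> complex) \<Rightarrow> bool" where
  "embedding \<phi> A \<psi> \<iota> \<longleftrightarrow> immersion \<phi> A \<psi> \<iota> \<and> inj_on \<iota> A"

definition Mtop :: "(complex \<Rightarrow> complex) set topology" where
  "Mtop = topology_generated_by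
     ({Mt}
      \<union> {{Q \<in> Mt. \<exists>\<psi>\<in>Q. \<exists>\<iota>. immersion \<phi> K \<psi> \<iota>} | \<phi> K. pointed_lh \<phi> \<and> cdisk K}
      \<union> {{Q \<in> Mt. \<not> (\<exists>\<psi>\<in>Q. \<exists>\<iota>. embedding \<phi> U \<psi> \<iota>)} | \<phi> U. pointed_lh \<phi> \<and> odisk U})"

definition Eplus :: "(complex \<Rightarrow> complex) \<Rightarrow> complex set \<Rightarrow> complex set \<Rightarrow> ((complex \<Rightarrow> complex) \<times> complex) set set" where
  "Eplus \<phi> K U = {E \<in> Et. \<exists>\<psi> z \<iota>. (\<psi>, z) \<in> E \<and> immersion \<phi> K \<psi> \<iota> \<and> z \<in> \<iota> ` U}"

definition Etop :: "((complex \<Rightarrow> complex) \<times> complex) set topology" where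
  "Etop = topology_generated_by
     ({Et}
      \<union> {{E \<in> Et. piE E \<in> W} | W. openin Mtop W}
      \<union> {Eplus \<phi> K U | \<phi> K U. pointed_lh \<phi> \<and> compact K \<and> PC K \<and> open U \<and> U \<subseteq> interior K})"

definition Homeo0 :: "(complex \<Rightarrow> complex) set" where
  "Homeo0 = {H. (\<exists>G. homeomorphism UNIV UNIV H G) \<and> H 0 = 0}"

definition HomeoTop :: "(complex \<Rightarrow> complex) topology" where
  "HomeoTop = topology_generated_by
     ({Homeo0} \<union> {{H \<in> Homeo0. H ` K \<subseteq> V} | K V. compact K \<and> open V})"

text \<open>The actions; for orientation-reversing H we use j = complex conjugation (j^-1 = j).\<close>
definition actM :: "(complex \<Rightarrow> complex) \<Rightarrow> (complex \<Rightarrow> complex) set \<Rightarrow> (complex \<Rightarrow> complex) set" where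
  "actM H P = (if orient_pres H then (\<lambda>\<phi>. H \<circ> \<phi>) ` P else (\<lambda>\<phi>. H \<circ> \<phi> \<circ> cnj) ` P)"

definition actE :: "(complex \<Rightarrow> complex) \<Rightarrow> ((complex \<Rightarrow> complex) \<times> complex) set \<Rightarrow> ((complex \<Rightarrow> complex) \<times> complex) set" where
  "actE H E = (if orient_pres H then (\<lambda>(\<phi>, y). (H \<circ> \<phi>, y)) ` E
               else (\<lambda>(\<phi>, y). (H \<circ> \<phi> \<circ> cnj, cnj y)) ` E)"

end

theory Submission
  imports Defs "HOL-Complex_Analysis.Riemann_Mapping"
begin

text \<open>
  The key is a lifting principle. If \<open>\<psi>\<close> is a local homeomorphism, \<open>C\<close> is compact and \<open>G\<close> is an
  injective map sufficiently close to the identity on \<open>\<psi> ` C\<close>, then moving each \<open>p \<in> C\<close> by the local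
  inverse branch of \<open>\<psi>\<close> at \<open>p\<close> gives an embedding \<open>T\<close> of \<open>C\<close>, close to the identity, with
  \<open>\<psi> \<circ> T = G \<circ> \<psi>\<close>. Let \<open>H\<close> be near \<open>H0\<close>. If \<open>\<iota>\<close> immerses \<open>K\<close> in \<open>H0 \<circ> \<psi>\<close>, and \<open>\<kappa>\<close> immerses a large
  disk of \<open>\<psi>\<close> in a nearby surface \<open>\<zeta>\<close>, then \<open>\<kappa> \<circ> T \<circ> \<iota>\<close>, with \<open>T\<close> the lift of \<open>G = H\<^sup>-\<^sup>1 \<circ> H0\<close>
  through \<open>\<psi>\<close>, immerses \<open>K\<close> in \<open>H \<circ> \<zeta>\<close>. If \<open>U\<close> does not embed in \<open>H0 \<circ> \<psi>\<close>, then, immersions being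
  unique, already some disk \<open>V\<close> with compact closure in \<open>U\<close> does not; an embedding \<open>\<iota>\<close> of \<open>U\<close> in
  \<open>H \<circ> \<zeta>\<close> would give the embedding \<open>\<iota> \<circ> T\<close> of \<open>V\<close>, developed by \<open>H0\<^sup>-\<^sup>1 \<circ> \<phi>\<close>, in \<open>\<zeta>\<close>, where now \<open>T\<close>
  lifts \<open>G = H0\<^sup>-\<^sup>1 \<circ> H\<close>. Orientation-reversing maps are reduced to orientation-preserving ones by
  conjugation, since \<open>H \<circ> \<phi> \<circ> cnj = (H \<circ> cnj) \<circ> (cnj \<circ> \<phi> \<circ> cnj)\<close> and both kinds form open subsets.
\<close>

subsection \<open>Orientation of plane homeomorphisms\<close>

lemma circle_loop_eq_circlepath: "circle_loop x r = circlepath x r"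
  by (auto simp: circle_loop_def circlepath)

text \<open>Both circles wind once around \<open>x\<close>, and closed paths in a punctured plane
  are classified up to homotopy by their winding number.\<close>

lemma homotopic_circle_loops:
  assumes "0 < r" "0 < s"
  shows "homotopic_loops (- {x}) (circle_loop x r) (circle_loop x s)"
  using assms winding_number_homotopic_loops_eq[of "circlepath x r" x "circlepath x s"]
  by (simp add: circle_loop_eq_circlepath winding_number_circlepath_centre)

text \<open>Serves the reflection \<open>cnj\<close>, which turns positively oriented circles into
  reversed ones.\<close>

lemma homotopic_loops_reversepath:
  assumes "homotopic_loops S p q"
  shows "homotopic_loops S (reversepath p) (reversepath q)"
proof -
  obtain h where h: "continuous_on ({0..1::real} \<times> {0..1::real}) h" "h \<in> ({0..1} \<times> {0..1}) \<rightarrow> S"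
      "\<And>x. x \<in> {0..1} \<Longrightarrow> h (0, x) = p x" "\<And>x. x \<in> {0..1} \<Longrightarrow> h (1, x) = q x"
      "\<And>t. t \<in> {0..1} \<Longrightarrow> pathfinish (h \<circ> Pair t) = pathstart (h \<circ> Pair t)"
    using assms unfolding homotopic_loops by auto
  let ?k = "h \<circ> (\<lambda>(s, t). (s, 1 - t))"
  have "continuous_on ({0..1} \<times> {0..1}) ?k"
    by (rule continuous_on_compose)
       (auto intro!: continuous_on_subset[OF h(1)] continuous_intros simp: case_prod_unfold)
  moreover have "?k \<in> ({0..1} \<times> {0..1}) \<rightarrow> S"
    using h(2) by fastforce
  moreover have "?k (0, x) = reversepath p x" "?k (1, x) = reversepath q x" if "x \<in> {0..1}" for x
    using that h(3,4) by (auto simp: reversepath_def)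
  moreover have "pathfinish (?k \<circ> Pair t) = pathstart (?k \<circ> Pair t)" if "t \<in> {0..1}" for t
    using h(5)[OF that] by (simp add: pathfinish_def pathstart_def)
  ultimately show ?thesis
    unfolding homotopic_loops by blast
qed

lemma homotopic_loops_compose_inj:
  assumes "homotopic_loops (- {x}) p q" "continuous_on UNIV H" "inj H"
  shows "homotopic_loops (- {H x}) (H \<circ> p) (H \<circ> q)"
  by (rule homotopic_loops_continuous_image[OF assms(1)])
     (use assms in \<open>auto intro: continuous_on_subset dest: injD\<close>)

text \<open>An injective \<open>H\<close> carries the homotopy between two concentric circles to one
  that avoids \<open>H x\<close>. All radii are therefore interchangeable, and the unit circle alone
  decides.\<close>

lemma orient_pres_at_inj_iff:
  assumes "continuous_on UNIV H" "inj H"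
  shows "orient_pres_at H x \<longleftrightarrow>
    homotopic_loops (- {H x}) (H \<circ> circle_loop x 1) (circle_loop (H x) 1)" (is "_ = ?R")
proof
  assume "orient_pres_at H x"
  then obtain e where e: "e > 0" and
    h: "\<And>r. 0 < r \<Longrightarrow> r < e \<Longrightarrow> homotopic_loops (- {H x}) (H \<circ> circle_loop x r) (circle_loop (H x) 1)"
    unfolding orient_pres_at_def by blast
  show ?R
    using homotopic_loops_compose_inj[OF homotopic_circle_loops[of 1 "e/2" x] assms] h[of "e/2"] e
    by (auto intro: homotopic_loops_trans)
next
  assume ?R
  then show "orient_pres_at H x"
    unfolding orient_pres_at_def
    using homotopic_loops_compose_inj[OF homotopic_circle_loops assms]
    by (metis homotopic_loops_trans zero_less_one)
qed

text \<open>The homotopy of the small circles of \<open>f\<close> is pushed forward by the injective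
  \<open>H\<close>, so that \<open>f\<close> may be a developing map.\<close>

lemma orient_pres_at_compose:
  assumes H: "continuous_on UNIV H" "inj H" and "orient_pres_at H (f x)" "orient_pres_at f x"
  shows "orient_pres_at (H \<circ> f) x"
proof -
  obtain e where e: "e > 0" and
    h: "\<And>r. 0 < r \<Longrightarrow> r < e \<Longrightarrow> homotopic_loops (- {f x}) (f \<circ> circle_loop x r) (circle_loop (f x) 1)"
    using assms unfolding orient_pres_at_def by blast
  have "homotopic_loops (- {H (f x)}) (H \<circ> f \<circ> circle_loop x r) (circle_loop (H (f x)) 1)"
    if "0 < r" "r < e" for r
    using homotopic_loops_compose_inj[OF h[OF that] H] assms(3) orient_pres_at_inj_iff[OF H]
    by (metis comp_assoc homotopic_loops_trans)
  with e show ?thesis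
    unfolding orient_pres_at_def by auto
qed

lemma orient_pres_compose:
  assumes "continuous_on UNIV H" "inj H" "orient_pres H" "orient_pres f"
  shows "orient_pres (H \<circ> f)"
  using assms orient_pres_at_compose unfolding orient_pres_def by blast

lemma homeomorphism_UNIV:
  assumes "homeomorphism UNIV UNIV H G"
  shows "continuous_on A H" "continuous_on A G" "inj H" "inj G" "G (H x) = x" "H (G x) = x"
    "surj H" "surj G"
  using assms unfolding homeomorphism_def
  by (auto intro: continuous_on_subset inj_on_inverseI)

text \<open>Pushing the homotopy for \<open>H\<close> at \<open>G y\<close> forward by
  \<open>G\<close> and reading it backwards gives the homotopy for \<open>G\<close> at
  \<open>y\<close>.\<close>

lemma orient_pres_inverse:
  assumes "homeomorphism UNIV UNIV H G" "orient_pres H"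
  shows "orient_pres G"
  unfolding orient_pres_def
proof
  fix y
  note h = homeomorphism_UNIV[OF assms(1)]
  have "homotopic_loops (- {y}) (H \<circ> circle_loop (G y) 1) (circle_loop y 1)"
    using assms(2) orient_pres_at_inj_iff[OF h(1,3), of "G y"] h(6)
    unfolding orient_pres_def by simp
  from homotopic_loops_compose_inj[OF this h(2,4)]
  have "homotopic_loops (- {G y}) (circle_loop (G y) 1) (G \<circ> circle_loop y 1)"
    using h(5) by (simp add: comp_def)
  then show "orient_pres_at G y"
    using orient_pres_at_inj_iff[OF h(2,4)] homotopic_loops_sym by blast
qed

lemma orient_pres_id: "orient_pres (\<lambda>x. x)"
  unfolding orient_pres_def
proof
  fix x :: complex
  show "orient_pres_at (\<lambda>x. x) x"
    using orient_pres_at_inj_iff[of "\<lambda>x. x" x] homotopic_circle_loops[of 1 1 x]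
    by (simp add: comp_def inj_def)
qed

lemma cnj_circle_loop: "cnj \<circ> circle_loop x r = reversepath (circle_loop (cnj x) r)"
  by (rule ext, simp add: circle_loop_def reversepath_def exp_cnj algebra_simps exp_diff exp_minus divide_inverse)

lemma compose_reversepath: "f \<circ> reversepath p = reversepath (f \<circ> p)"
  by (auto simp: reversepath_def)

lemma cnj_reversepath_circle_loop: "cnj \<circ> reversepath (circle_loop x r) = circle_loop (cnj x) r"
proof -
  have "cnj \<circ> (cnj \<circ> circle_loop (cnj x) r) = circle_loop (cnj x) r" by auto
  then show ?thesis by (simp only: cnj_circle_loop complex_cnj_cnj)
qed

lemma continuous_on_cnj' [simp]: "continuous_on A cnj"
  by (intro continuous_intros)

lemma inj_cnj [simp]: "inj cnj"
  by (auto intro: injI)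

text \<open>The inner and the outer reflection each reverse a circle, and the two reversals
  cancel.\<close>

lemma orient_pres_cnj_conj:
  assumes "orient_pres f"
  shows "orient_pres (cnj \<circ> f \<circ> cnj)"
  unfolding orient_pres_def
proof
  fix x
  obtain e where e: "e > 0" and
    h: "\<And>r. 0 < r \<Longrightarrow> r < e \<Longrightarrow> homotopic_loops (- {f (cnj x)})
          (f \<circ> circle_loop (cnj x) r) (circle_loop (f (cnj x)) 1)"
    using assms unfolding orient_pres_at_def orient_pres_def by blast
  have "homotopic_loops (- {(cnj \<circ> f \<circ> cnj) x}) (cnj \<circ> f \<circ> cnj \<circ> circle_loop x r)
      (circle_loop ((cnj \<circ> f \<circ> cnj) x) 1)" if "0 < r" "r < e" for r
    using homotopic_loops_compose_inj[OF homotopic_loops_reversepath[OF h[OF that]],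
        of cnj, unfolded cnj_reversepath_circle_loop]
    by (simp add: comp_assoc cnj_circle_loop compose_reversepath)
  with e show "orient_pres_at (cnj \<circ> f \<circ> cnj) x"
    unfolding orient_pres_at_def by blast
qed

section \<open>Winding numbers and orientation\<close>

lemma path_circle_loop [simp]: "path (circle_loop x r)"
  by (simp add: circle_loop_eq_circlepath)

lemma inj_circle_loop_avoids:
  assumes "inj H"
  shows "H x \<notin> path_image (H \<circ> circle_loop x 1)"
  using assms by (auto simp: path_image_compose circle_loop_eq_circlepath dest: injD)

lemma path_inj_circle_loop:
  assumes "continuous_on UNIV H"
  shows "path (H \<circ> circle_loop x r)"
  by (rule path_continuous_image) (use assms in \<open>auto intro: continuous_on_subset\<close>)

lemma closed_inj_circle_loop:
  "pathfinish (H \<circ> circle_loop x r) = pathstart (H \<circ> circle_loop x r)"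
  by (simp add: circle_loop_eq_circlepath pathstart_compose pathfinish_compose)

lemma orient_pres_at_iff_winding_number:
  assumes "continuous_on UNIV H" "inj H"
  shows "orient_pres_at H x \<longleftrightarrow> winding_number (H \<circ> circle_loop x 1) (H x) = 1"
proof -
  have "winding_number (circlepath (H x) 1) (H x) = 1"
    by (simp add: winding_number_circlepath_centre)
  then show ?thesis
    unfolding orient_pres_at_inj_iff[OF assms]
    using winding_number_homotopic_loops_eq[of "H \<circ> circle_loop x 1" "H x" "circle_loop (H x) 1"]
      inj_circle_loop_avoids[OF assms(2)] path_inj_circle_loop[OF assms(1)]
      closed_inj_circle_loop[of H x 1]
    by (simp add: circle_loop_eq_circlepath)
qed

text \<open>Slide the centre along the segment from \<open>x\<close> to \<open>y\<close> and
  translate its image to 0. Injectivity of \<open>H\<close> keeps the moving loop away from 0, so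
  the winding number does not change. Orientation at one point thus decides it everywhere.\<close>

lemma winding_number_inj_const:
  assumes H: "continuous_on UNIV H" "inj H"
  shows "winding_number (H \<circ> circle_loop x 1) (H x) = winding_number (H \<circ> circle_loop y 1) (H y)"
proof -
  let ?m = "\<lambda>s. x + of_real s * (y - x)"
  let ?h = "\<lambda>(s, t). H (circle_loop (?m s) 1 t) - H (?m s)"
  have "homotopic_loops (- {0}) (\<lambda>t. H (circle_loop x 1 t) - H x) (\<lambda>t. H (circle_loop y 1 t) - H y)"
    unfolding homotopic_loops
  proof (intro exI[of _ ?h] conjI)
    show "continuous_on ({0..1} \<times> {0..1}) ?h"
      unfolding circle_loop_def case_prod_unfold
      by (intro continuous_intros continuous_on_compose2[OF H(1)]) auto
    have "circle_loop z 1 t \<noteq> z" for z t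
      by (simp add: circle_loop_def)
    then show "?h \<in> ({0..1} \<times> {0..1}) \<rightarrow> - {0}"
      using H(2) by (auto simp: inj_eq)
  qed (simp_all add: circle_loop_def pathfinish_def pathstart_def)
  then have "winding_number (\<lambda>t. H (circle_loop x 1 t) - H x) 0 = winding_number (\<lambda>t. H (circle_loop y 1 t) - H y) 0"
    by (rule winding_number_homotopic_loops)
  then show ?thesis
    using winding_number_offset[of "H \<circ> circle_loop x 1" "H x"]
      winding_number_offset[of "H \<circ> circle_loop y 1" "H y"]
    by (simp add: comp_def)
qed

lemma orient_pres_iff_winding_number:
  assumes "continuous_on UNIV H" "inj H"
  shows "orient_pres H \<longleftrightarrow> winding_number (H \<circ> circle_loop 0 1) (H 0) = 1"
  unfolding orient_pres_def orient_pres_at_iff_winding_number[OF assms]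
proof
  show "winding_number (H \<circ> circle_loop 0 1) (H 0) = 1"
    if "\<forall>x. winding_number (H \<circ> circle_loop x 1) (H x) = 1" using that by blast
  show "\<forall>x. winding_number (H \<circ> circle_loop x 1) (H x) = 1"
    if "winding_number (H \<circ> circle_loop 0 1) (H 0) = 1"
    using trans[OF winding_number_inj_const[OF assms] that] by blast
qed

text \<open>Since \<open>S\<close> misses the image of the sphere, it is covered by two disjoint
  open sets: the image of the open ball and the complement of the compact image of the closed ball.
  A connected \<open>S\<close> that meets the first lies in it.\<close>

lemma connected_subset_image_ball:
  fixes f :: "'a::heine_borel \<Rightarrow> 'b::t2_space"
  assumes "continuous_on (cball p d) f" "open (f ` ball p d)" "connected S"
    and avoid: "S \<inter> f ` sphere p d = {}" and meet: "S \<inter> f ` ball p d \<noteq> {}"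
  shows "S \<subseteq> f ` ball p d"
proof -
  let ?U = "f ` ball p d" and ?V = "- f ` cball p d"
  have op: "open ?V"
    using assms(1) by (simp add: compact_continuous_image compact_imp_closed open_Compl)
  have "cball p d = ball p d \<union> sphere p d" by auto
  then have eq: "f ` cball p d = ?U \<union> f ` sphere p d"
    by (metis image_Un)
  have "S \<subseteq> ?U \<union> ?V" "?U \<inter> ?V \<inter> S = {}"
    using avoid unfolding eq by blast+
  then have "?U \<inter> S = {} \<or> ?V \<inter> S = {}"
    using connectedD[OF assms(3,2) op] by metis
  with \<open>S \<subseteq> ?U \<union> ?V\<close> meet show ?thesis by blast
qed

text \<open>The image of the closed disk is the closure of the inside of the image circle, so the
  winding number of a simple closed curve applies.\<close>

lemma homeomorphism_winding_number_cases:
  assumes "homeomorphism UNIV UNIV H G"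
  shows "winding_number (H \<circ> circle_loop x 1) (H x) \<in> {1, -1}"
proof -
  note h = homeomorphism_UNIV[OF assms]
  have pim: "path_image (H \<circ> circle_loop x 1) = H ` sphere x 1"
    by (simp add: path_image_compose circle_loop_eq_circlepath)
  have sp: "simple_path (H \<circ> circle_loop x 1)"
    using h by (intro simple_path_continuous_image)
       (auto simp: circle_loop_eq_circlepath simple_path_circlepath intro: inj_on_subset)
  let ?c = "connected_component_set (- H ` sphere x 1) (H x)"
  have hx: "H x \<in> ?c" using h(3) by (simp add: inj_image_mem_iff)
  have "?c \<subseteq> H ` ball x 1"
  proof (rule connected_subset_image_ball)
    show "open (H ` ball x 1)"
      using homeomorphism_imp_open_map[OF assms, of "ball x 1"] by simp
    show "?c \<inter> H ` sphere x 1 = {}"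
      using connected_component_subset[of "- H ` sphere x 1"] by blast
    show "?c \<inter> H ` ball x 1 \<noteq> {}"
      using hx imageI[of x "ball x 1" H] by (metis centre_in_ball disjoint_iff zero_less_one)
  qed (auto intro: h)
  moreover have "bounded (H ` ball x 1)"
    by (rule bounded_subset[of "H ` cball x 1"])
       (auto intro!: compact_imp_bounded compact_continuous_image h)
  ultimately have "H x \<in> inside (path_image (H \<circ> circle_loop x 1))"
    using h(3) bounded_subset unfolding pim inside_def by (auto simp: inj_image_mem_iff)
  then show ?thesis
    using simple_closed_path_winding_number_inside[OF sp] by blast
qed

text \<open>The winding number is 1 or -1. If \<open>H\<close> does not preserve orientation it is
  -1, and reversing the circle by \<open>cnj\<close> changes the sign.\<close>

lemma orient_pres_compose_cnj:
  assumes "homeomorphism UNIV UNIV H G" "\<not> orient_pres H"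
  shows "orient_pres (H \<circ> cnj)"
proof -
  note h = homeomorphism_UNIV[OF assms(1)]
  have "winding_number (H \<circ> circle_loop 0 1) (H 0) = -1"
    using homeomorphism_winding_number_cases[OF assms(1), of 0] assms(2)
      orient_pres_iff_winding_number[OF h(1,3)] by auto
  then have "winding_number (H \<circ> cnj \<circ> circle_loop 0 1) (H 0) = 1"
    using winding_number_reversepath[OF path_inj_circle_loop[OF h(1)] inj_circle_loop_avoids[OF h(3)], of 0]
    by (simp add: comp_assoc cnj_circle_loop compose_reversepath)
  moreover have "continuous_on UNIV (H \<circ> cnj)" "inj (H \<circ> cnj)"
    by (rule continuous_on_compose[OF continuous_on_cnj' h(1)], rule inj_compose[OF h(3) inj_cnj])
  ultimately show ?thesis
    using orient_pres_iff_winding_number[of "H \<circ> cnj"] by simp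
qed

lemma homeomorphism_cnj: "homeomorphism UNIV UNIV cnj cnj"
  by (rule homeomorphismI) auto


subsection \<open>Local homeomorphisms\<close>

lemma local_homeo_open_map:
  assumes "local_homeo f" "open S"
  shows "open (f ` S)"
proof (subst open_subopen, clarify)
  fix x assume "x \<in> S"
  obtain U g where U: "open U" "x \<in> U" "open (f ` U)" "homeomorphism U (f ` U) f g"
    using assms unfolding local_homeo_def by metis
  have "openin (top_of_set (f ` U)) (f ` (U \<inter> S))"
    by (rule homeomorphism_imp_open_map[OF U(4)]) (use assms in \<open>auto simp: openin_open\<close>)
  with U have "open (f ` (U \<inter> S))"
    by (meson openin_open_eq)
  with U \<open>x \<in> S\<close> show "\<exists>T. open T \<and> f x \<in> T \<and> T \<subseteq> f ` S"
    by (intro exI[of _ "f ` (U \<inter> S)"]) auto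
qed

text \<open>By invariance of domain, a continuous locally injective map of the plane automatically
  has open local images and continuous local inverses.\<close>

lemma local_homeo_iff:
  "local_homeo f \<longleftrightarrow> continuous_on UNIV f \<and> (\<forall>x. \<exists>U. open U \<and> x \<in> U \<and> inj_on f U)" (is "_ = ?R")
proof
  assume "local_homeo f"
  then show ?R
    unfolding local_homeo_def homeomorphism_def by (metis inj_on_inverseI)
next
  assume R: ?R
  have "\<exists>U. open U \<and> x \<in> U \<and> open (f ` U) \<and> (\<exists>g. homeomorphism U (f ` U) f g)" for x
  proof -
    obtain U where U: "open U" "x \<in> U" "inj_on f U" using R by blast
    have c: "continuous_on U f" using R continuous_on_subset by blast
    obtain g where "homeomorphism U (f ` U) f g"
      by (rule invariance_of_domain_homeomorphism[OF U(1) c _ U(3)]) auto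
    with U invariance_of_domain[OF c U(1,3)] show ?thesis by blast
  qed
  with R show "local_homeo f" unfolding local_homeo_def by blast
qed

lemma local_homeo_compose:
  assumes "local_homeo f" "local_homeo g"
  shows "local_homeo (f \<circ> g)"
  unfolding local_homeo_iff
proof (intro conjI allI)
  have c: "continuous_on UNIV f" "continuous_on UNIV g"
    using assms by (auto simp: local_homeo_iff)
  show "continuous_on UNIV (f \<circ> g)"
    using c continuous_on_compose continuous_on_subset by blast
  fix x
  obtain U V where "open U" "x \<in> U" "inj_on g U" "open V" "g x \<in> V" "inj_on f V"
    using assms unfolding local_homeo_iff by meson
  moreover have "open (g -` V)"
    using c(2) \<open>open V\<close> by (simp add: open_vimage)
  ultimately show "\<exists>U. open U \<and> x \<in> U \<and> inj_on (f \<circ> g) U"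
    by (intro exI[of _ "U \<inter> g -` V"] conjI) (auto intro!: comp_inj_on intro: inj_on_subset)
qed

lemma local_homeo_homeomorphism:
  assumes "homeomorphism UNIV UNIV H G"
  shows "local_homeo H"
  using homeomorphism_UNIV[OF assms] unfolding local_homeo_iff by (metis UNIV_I open_UNIV)

section \<open>Lifting maps near the identity through a local homeomorphism\<close>

lemma local_homeo_uniform_inj:
  assumes "local_homeo f" "compact C"
  obtains e where "e > 0" "\<And>p. p \<in> C \<Longrightarrow> inj_on f (ball p e)"
proof -
  obtain e where "0 < e" "\<And>x. x \<in> C \<Longrightarrow> \<exists>G \<in> {U. open U \<and> inj_on f U}. ball x e \<subseteq> G"
    using assms(1)
    by (rule_tac Heine_Borel_lemma[OF assms(2), of "{U. open U \<and> inj_on f U}"])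
       (auto simp: local_homeo_iff)
  then show ?thesis
    using that inj_on_subset by (metis (no_types, lifting) mem_Collect_eq)
qed

text \<open>A positive continuous function on a compact set has a positive minimum, which makes the
  pointwise inequality uniform in the centre \<open>p\<close>.\<close>

lemma compact_dist_gap:
  fixes f :: "complex \<Rightarrow> complex"
  assumes "continuous_on UNIV f" "compact C"
    and ne: "\<And>p u. p \<in> C \<Longrightarrow> dist p u = d \<Longrightarrow> f u \<noteq> f p"
  obtains \<epsilon> where "\<epsilon> > 0" "\<And>p u. p \<in> C \<Longrightarrow> dist p u = d \<Longrightarrow> \<epsilon> \<le> dist (f u) (f p)"
proof (cases "C \<times> sphere (0::complex) d = {}")
  \<comment> \<open>The product is empty only for empty \<open>C\<close> or negative
    \<open>d\<close>. No pair then satisfies the conditions, and any positive constant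
    serves.\<close>
  case True
  then have "False" if "p \<in> C" "dist p u = d" for p u
    using that by (auto simp: dist_norm dest: spec[of _ "p - u"])
  with that[of 1] show ?thesis by (metis zero_less_one)
next
  case False
  \<comment> \<open>Pairs are written as centre and displacement, so that the domain is a product of
    compact sets.\<close>
  let ?h = "\<lambda>z. dist (f (fst z + snd z)) (f (fst z))"
  have "continuous_on (C \<times> sphere 0 d) ?h"
    by (intro continuous_intros continuous_on_compose2[OF assms(1)]) auto
  then have "\<exists>z\<in>C \<times> sphere 0 d. \<forall>y\<in>C \<times> sphere 0 d. ?h z \<le> ?h y"
    using False assms(2) by (intro continuous_attains_inf) (auto intro: compact_Times)
  then obtain z where z: "z \<in> C \<times> sphere 0 d" "\<And>y. y \<in> C \<times> sphere 0 d \<Longrightarrow> ?h z \<le> ?h y"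
    by metis
  show ?thesis
  proof
    show "?h z > 0"
      using z(1) ne[of "fst z" "fst z + snd z"] by (auto simp: dist_norm)
    show "?h z \<le> dist (f u) (f p)" if "p \<in> C" "dist p u = d" for p u
      using z(2)[of "(p, u - p)"] that by (auto simp: dist_norm norm_minus_commute)
  qed
qed

text \<open>A quantitative form of openness. The values on the sphere keep distance
  \<open>\<epsilon>\<close> from the value at the centre, so the connected ball of that radius
  cannot leave the image.\<close>

lemma ball_subset_image_ball:
  fixes f :: "complex \<Rightarrow> complex"
  assumes "continuous_on (cball p d) f" "open (f ` ball p d)" "d > 0"
    and gap: "\<And>u. dist p u = d \<Longrightarrow> \<epsilon> \<le> dist (f u) (f p)"
  shows "ball (f p) \<epsilon> \<subseteq> f ` ball p d"
proof (cases "\<epsilon> > 0")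
  case True
  show ?thesis
  proof (rule connected_subset_image_ball[OF assms(1,2)])
    show "ball (f p) \<epsilon> \<inter> f ` sphere p d = {}"
      using gap by (force simp: dist_commute)
    show "ball (f p) \<epsilon> \<inter> f ` ball p d \<noteq> {}"
      using True assms(3) by (metis centre_in_ball disjoint_iff imageI)
  qed auto
qed (simp add: ball_empty not_less)

text \<open>The bound \<open>\<epsilon>\<close> does not depend on \<open>G\<close>, so uniform
  closeness of homeomorphisms on a compact set is enough to lift. The clause on fixed values makes
  \<open>T\<close> fix the basepoint when \<open>G\<close> fixes the origin.\<close>

lemma local_homeo_lift_near_identity:
  assumes \<psi>: "local_homeo \<psi>" and C: "compact C" and \<eta>: "\<eta> > 0"
  obtains \<epsilon> where "\<epsilon> > 0"
    "\<And>G. continuous_on (\<psi> ` C) G \<Longrightarrow> inj_on G (\<psi> ` C) \<Longrightarrow>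
        \<forall>p\<in>C. dist (G (\<psi> p)) (\<psi> p) < \<epsilon> \<Longrightarrow>
        \<exists>T. continuous_on C T \<and> inj_on T C \<and>
          (\<forall>p\<in>C. dist (T p) p < \<eta> \<and> \<psi> (T p) = G (\<psi> p) \<and> (G (\<psi> p) = \<psi> p \<longrightarrow> T p = p))"
proof -
  have cont: "continuous_on A \<psi>" for A
    using \<psi> continuous_on_subset unfolding local_homeo_iff by blast
  obtain e where e: "e > 0" and inj: "\<And>p. p \<in> C \<Longrightarrow> inj_on \<psi> (ball p e)"
    using local_homeo_uniform_inj[OF \<psi> C] by blast
  \<comment> \<open>Smaller than \<open>\<eta>\<close> for closeness to the identity, and with
    \<open>2 * d < e\<close> so that lifts belonging to neighbouring points still lie in one
    injectivity ball.\<close>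
  define d where "d = min (e / 2) \<eta> / 2"
  have d: "0 < d" "2 * d < e" "d < \<eta>" using e \<eta> by (auto simp: d_def)
  have "\<psi> u \<noteq> \<psi> p" if "p \<in> C" "dist p u = d" for p u
    using inj_onD[OF inj[OF that(1)], of u p] that d e by auto
  then obtain \<epsilon> where \<epsilon>: "\<epsilon> > 0" and gap: "\<And>p u. p \<in> C \<Longrightarrow> dist p u = d \<Longrightarrow> \<epsilon> \<le> dist (\<psi> u) (\<psi> p)"
    using compact_dist_gap[OF cont C, of d] by metis
  show ?thesis
  proof (rule that[OF \<epsilon>])
    fix G assume G: "continuous_on (\<psi> ` C) G" "inj_on G (\<psi> ` C)"
      and near: "\<forall>p\<in>C. dist (G (\<psi> p)) (\<psi> p) < \<epsilon>"
    have "\<exists>q. q \<in> ball p d \<and> \<psi> q = G (\<psi> p)" if "p \<in> C" for p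
    proof -
      have "ball (\<psi> p) \<epsilon> \<subseteq> \<psi> ` ball p d"
        by (rule ball_subset_image_ball[OF cont local_homeo_open_map[OF \<psi> open_ball] d(1) gap[OF that]])
      moreover have "G (\<psi> p) \<in> ball (\<psi> p) \<epsilon>" using near that by (simp add: dist_commute)
      ultimately show ?thesis by (metis imageE subsetD)
    qed
    then obtain T where T: "\<And>p. p \<in> C \<Longrightarrow> dist p (T p) < d" "\<And>p. p \<in> C \<Longrightarrow> \<psi> (T p) = G (\<psi> p)"
      unfolding mem_ball by metis
    \<comment> \<open>The lift was chosen within \<open>d\<close> of \<open>p\<close> but is unique
      even within \<open>2 * d\<close>. Continuity uses this slack.\<close>
    have uniq: "T p = q" if "p \<in> C" "\<psi> q = G (\<psi> p)" "dist p q < 2 * d" for p q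
      using inj_onD[OF inj[OF that(1)], of "T p" q] T[OF that(1)] that d by auto
    have "continuous_on C T"
      unfolding continuous_on_topological
    proof (intro ballI allI impI)
      fix p B assume p: "p \<in> C" and B: "open B" "T p \<in> B"
      \<comment> \<open>As \<open>\<psi>\<close> is open, each value near
        \<open>G (\<psi> p)\<close> is attained inside \<open>B\<close> and within \<open>d\<close>
        of \<open>p\<close>. For \<open>y\<close> near \<open>p\<close> this preimage is within
        \<open>2 * d\<close> of \<open>y\<close>, hence equal to \<open>T y\<close>.\<close>
      let ?N = "\<psi> ` (B \<inter> ball p d)"
      have "open ?N" using B by (intro local_homeo_open_map[OF \<psi>]) auto
      moreover have "G (\<psi> p) \<in> ?N" using T[OF p] B by (metis IntI imageI mem_ball)
      moreover have "continuous_on C (\<lambda>p. G (\<psi> p))"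
        by (intro continuous_on_compose2[OF G(1)] cont) auto
      ultimately obtain A where A: "open A" "p \<in> A" "\<forall>y\<in>C. y \<in> A \<longrightarrow> G (\<psi> y) \<in> ?N"
        using p unfolding continuous_on_topological by meson
      have "T y \<in> B" if y: "y \<in> C" "y \<in> A \<inter> ball p d" for y
      proof -
        have "G (\<psi> y) \<in> ?N" using A(3) y by blast
        then obtain q where q: "q \<in> B" "dist p q < d" "\<psi> q = G (\<psi> y)"
          by (auto elim!: imageE)
        have "dist y q < 2 * d"
          using q(2) y(2) dist_triangle[of y q p] by (simp add: dist_commute)
        with uniq y q show ?thesis by metis
      qed
      then show "\<exists>A. open A \<and> p \<in> A \<and> (\<forall>y\<in>C. y \<in> A \<longrightarrow> T y \<in> B)"
        using A d by (intro exI[of _ "A \<inter> ball p d"]) auto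
    qed
    moreover have "inj_on T C"
    proof (rule inj_onI)
      fix p p' assume p: "p \<in> C" "p' \<in> C" "T p = T p'"
      \<comment> \<open>Equal lifts have equal values of \<open>G\<close>, which is injective. Both
        points are within \<open>d\<close> of the common lift, so they share an injectivity ball of
        \<open>\<psi>\<close>.\<close>
      then have "\<psi> p = \<psi> p'"
        using T(2) G(2) by (metis imageI inj_onD)
      moreover have "dist p p' < e"
        using T(1)[OF p(1)] T(1)[OF p(2)] p(3) dist_triangle2[of p p' "T p"] d by simp
      ultimately show "p = p'"
        using inj_onD[OF inj[OF p(1)], of p p'] e by auto
    qed
    moreover have "T p = p" if "p \<in> C" "G (\<psi> p) = \<psi> p" for p
      using uniq[of p p] that d by simp
    ultimately show "\<exists>T. continuous_on C T \<and> inj_on T C \<and>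
        (\<forall>p\<in>C. dist (T p) p < \<eta> \<and> \<psi> (T p) = G (\<psi> p) \<and> (G (\<psi> p) = \<psi> p \<longrightarrow> T p = p))"
      using T d by (intro exI[of _ T]) (force simp: dist_commute)
  qed
qed

subsection \<open>The compact-open topology\<close>

lemma Homeo0_E:
  assumes "H \<in> Homeo0"
  obtains G where "homeomorphism UNIV UNIV H G" "H 0 = 0" "G 0 = 0"
proof -
  obtain G where G: "homeomorphism UNIV UNIV H G" "H 0 = 0" using assms unfolding Homeo0_def by blast
  with homeomorphism_UNIV(5)[OF G(1), of 0] show ?thesis by (intro that[of G]) auto
qed

lemma topspace_HomeoTop [simp]: "topspace HomeoTop = Homeo0"
  by (auto simp: HomeoTop_def topology_generated_by_topspace)

text \<open>Cover \<open>C\<close> by finitely many balls on whose closures \<open>H0\<close> varies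
  by less than \<open>\<epsilon> / 2\<close>, and let \<open>H\<close> send each closed ball into
  the same small target ball as \<open>H0\<close> does.\<close>

lemma HomeoTop_uniform_nbhd:
  assumes H0: "H0 \<in> Homeo0" and C: "compact C" and \<epsilon>: "\<epsilon> > 0"
  obtains N where "openin HomeoTop N" "H0 \<in> N" "\<And>H. H \<in> N \<Longrightarrow> H \<in> Homeo0"
    "\<And>H x. H \<in> N \<Longrightarrow> x \<in> C \<Longrightarrow> dist (H x) (H0 x) < \<epsilon>"
proof -
  obtain G0 where "homeomorphism UNIV UNIV H0 G0" using Homeo0_E[OF H0] by blast
  then have c: "isCont H0 x" for x
    using homeomorphism_UNIV(1)[of H0 G0 UNIV] by (simp add: continuous_on_eq_continuous_at)
  have "\<exists>r>0. H0 ` cball x r \<subseteq> ball (H0 x) (\<epsilon> / 2)" for x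
  proof -
    obtain r where r: "r > 0" "\<And>y. dist y x < r \<Longrightarrow> dist (H0 y) (H0 x) < \<epsilon> / 2"
      using c[of x] \<epsilon> unfolding continuous_at_eps_delta by (metis half_gt_zero)
    then show ?thesis
      by (intro exI[of _ "r / 2"]) (auto simp: dist_commute intro!: r(2))
  qed
  then obtain r where r: "\<And>x. r x > 0" "\<And>x. H0 ` cball x (r x) \<subseteq> ball (H0 x) (\<epsilon> / 2)"
    by metis
  obtain D where D: "D \<subseteq> C" "finite D" "C \<subseteq> (\<Union>x\<in>D. ball x (r x))"
    by (rule compactE_image[OF C, of C "\<lambda>x. ball x (r x)"]) (use r(1) in auto)
  \<comment> \<open>The factor \<open>Homeo0\<close> makes \<open>N\<close> a set of homeomorphisms
    even if \<open>C\<close>, and with it the index set \<open>D\<close>, is empty.\<close>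
  define N where "N = (\<Inter>x\<in>D. {H \<in> Homeo0. H ` cball x (r x) \<subseteq> ball (H0 x) (\<epsilon> / 2)}) \<inter> Homeo0"
  show ?thesis
  proof
    have "openin HomeoTop {H \<in> Homeo0. H ` cball x (r x) \<subseteq> ball (H0 x) (\<epsilon> / 2)}" for x
      unfolding HomeoTop_def by (intro topology_generated_by_Basis) (blast intro: compact_cball open_ball)
    moreover have "openin HomeoTop Homeo0" using openin_topspace[of HomeoTop] by simp
    ultimately show "openin HomeoTop N"
      unfolding N_def by (cases "D = {}") (auto intro!: openin_Int openin_INT2 D(2))
    show "H0 \<in> N" using H0 r(2) unfolding N_def by blast
    fix H assume N: "H \<in> N"
    then show "H \<in> Homeo0" unfolding N_def by blast
    fix x assume "x \<in> C"
    then obtain z where z: "z \<in> D" "x \<in> cball z (r z)" using D(3) by fastforce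
    then have "H x \<in> ball (H0 z) (\<epsilon> / 2)" using N unfolding N_def by blast
    moreover have "H0 x \<in> ball (H0 z) (\<epsilon> / 2)" using r(2) z(2) by blast
    ultimately show "dist (H x) (H0 x) < \<epsilon>"
      using dist_triangle3[of "H x" "H0 x" "H0 z"] by simp
  qed
qed

text \<open>No inverse is estimated directly: \<open>H\<close> maps small spheres around \<open>x\<close> far from \<open>H0 x\<close>, so by
  connectedness \<open>H\<close> of the ball contains \<open>H0 x\<close>.\<close>

lemma HomeoTop_inverse_nbhd:
  assumes H0: "H0 \<in> Homeo0" and C: "compact C" and \<epsilon>: "\<epsilon> > 0"
  obtains N where "openin HomeoTop N" "H0 \<in> N" "\<And>H. H \<in> N \<Longrightarrow> H \<in> Homeo0"
    "\<And>H G x. H \<in> N \<Longrightarrow> homeomorphism UNIV UNIV H G \<Longrightarrow> x \<in> C \<Longrightarrow> dist (G (H0 x)) x < \<epsilon>"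
proof -
  obtain G0 where G0: "homeomorphism UNIV UNIV H0 G0" using Homeo0_E[OF H0] by blast
  note h = homeomorphism_UNIV[OF G0]
  have "H0 u \<noteq> H0 p" if "dist p u = \<epsilon>" for p u
    using that \<epsilon> h(3) by (metis dist_self injD less_irrefl)
  then obtain \<delta> where \<delta>: "\<delta> > 0" and gap: "\<And>p u. p \<in> C \<Longrightarrow> dist p u = \<epsilon> \<Longrightarrow> \<delta> \<le> dist (H0 u) (H0 p)"
    using compact_dist_gap[OF h(1) C, of \<epsilon>] by metis
  \<comment> \<open>The closed \<open>\<epsilon>\<close>-neighbourhood of \<open>C\<close>, compact
    as the image of a product.\<close>
  let ?D = "(\<lambda>z. fst z + snd z) ` (C \<times> cball 0 \<epsilon>)"
  have cD: "compact ?D"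
    by (intro compact_continuous_image compact_Times C compact_cball continuous_intros)
  have inD: "u \<in> ?D" if "p \<in> C" "dist p u \<le> \<epsilon>" for p u
    using that by (intro image_eqI[of _ _ "(p, u - p)"]) (auto simp: dist_norm norm_minus_commute)
  \<comment> \<open>Passing from \<open>H0\<close> to \<open>H\<close> costs one third of the gap at
    the centre and one third on the sphere. The remaining third still exceeds the distance from
    \<open>H x\<close> to \<open>H0 x\<close>.\<close>
  have \<delta>3: "\<delta> / 3 > 0" using \<delta> by simp
  obtain N where N: "openin HomeoTop N" "H0 \<in> N" "\<And>H. H \<in> N \<Longrightarrow> H \<in> Homeo0"
      and near: "\<And>H u. H \<in> N \<Longrightarrow> u \<in> ?D \<Longrightarrow> dist (H u) (H0 u) < \<delta> / 3"
    by (rule HomeoTop_uniform_nbhd[OF H0 cD \<delta>3]) (rule that)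
  show ?thesis
  proof (rule that[OF N])
    fix H G x assume H: "H \<in> N" "homeomorphism UNIV UNIV H G" and x: "x \<in> C"
    note hh = homeomorphism_UNIV[OF H(2)]
    have nx: "dist (H x) (H0 x) < \<delta> / 3" using near[OF H(1) inD[OF x]] \<epsilon> by simp
    have "ball (H x) (\<delta> / 3) \<subseteq> H ` ball x \<epsilon>"
    proof (rule ball_subset_image_ball[OF hh(1) _ \<epsilon>])
      show "open (H ` ball x \<epsilon>)"
        using local_homeo_open_map local_homeo_homeomorphism H(2) by blast
      fix u assume u: "dist x u = \<epsilon>"
      then have "dist (H u) (H0 u) < \<delta> / 3" using near[OF H(1) inD[OF x]] by simp
      with nx gap[OF x u] show "\<delta> / 3 \<le> dist (H u) (H x)"
        using dist_triangle[of "H0 u" "H0 x" "H u"] dist_triangle[of "H u" "H0 x" "H x"]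
        by (simp add: dist_commute)
    qed
    with nx have "H0 x \<in> H ` ball x \<epsilon>" by auto
    then show "dist (G (H0 x)) x < \<epsilon>" using hh(5) by (auto simp: dist_commute)
  qed (use N in auto)
qed

text \<open>The inverse applied last is now that of the fixed map \<open>H0\<close>, so uniform
  continuity of \<open>G0\<close> near the compact image of \<open>C\<close> suffices.\<close>

lemma HomeoTop_inverse_nbhd':
  assumes H0: "homeomorphism UNIV UNIV H0 G0" "H0 \<in> Homeo0" and C: "compact C" and \<epsilon>: "\<epsilon> > 0"
  obtains N where "openin HomeoTop N" "H0 \<in> N" "\<And>H. H \<in> N \<Longrightarrow> H \<in> Homeo0"
    "\<And>H x. H \<in> N \<Longrightarrow> x \<in> C \<Longrightarrow> dist (G0 (H x)) x < \<epsilon>"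
proof -
  note h = homeomorphism_UNIV[OF H0(1)]
  \<comment> \<open>The closed 1-neighbourhood of the image of \<open>C\<close> under
    \<open>H0\<close>. It contains \<open>H x\<close> as soon as \<open>H x\<close> is within 1 of
    \<open>H0 x\<close>, hence the bound \<open>min \<delta> 1\<close> below.\<close>
  let ?D = "(\<lambda>z. fst z + snd z) ` ((H0 ` C) \<times> cball 0 1)"
  have "compact ?D"
    by (intro compact_continuous_image compact_Times C compact_cball continuous_intros h)
  then have "uniformly_continuous_on ?D G0"
    using h compact_uniformly_continuous by blast
  then obtain \<delta> where \<delta>: "\<delta> > 0"
    "\<And>u v. u \<in> ?D \<Longrightarrow> v \<in> ?D \<Longrightarrow> dist v u < \<delta> \<Longrightarrow> dist (G0 v) (G0 u) < \<epsilon>"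
    using \<epsilon> unfolding uniformly_continuous_on_def by (elim allE[of _ \<epsilon>]) blast
  have inD: "u \<in> ?D" if "x \<in> C" "dist u (H0 x) < 1" for x u
    using that by (intro image_eqI[of _ _ "(H0 x, u - H0 x)"]) (auto simp: dist_norm norm_minus_commute less_imp_le)
  have "min \<delta> 1 > 0" using \<delta> by simp
  from H0(2) C this obtain N where N: "openin HomeoTop N" "H0 \<in> N" "\<And>H. H \<in> N \<Longrightarrow> H \<in> Homeo0"
      and near: "\<And>H x. H \<in> N \<Longrightarrow> x \<in> C \<Longrightarrow> dist (H x) (H0 x) < min \<delta> 1"
    by (rule HomeoTop_uniform_nbhd) (rule that)
  show ?thesis
  proof (rule that[OF N])
    fix H x assume H: "H \<in> N" "x \<in> C"
    show "dist (G0 (H x)) x < \<epsilon>"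
      using \<delta>(2)[OF inD[OF H(2), of "H0 x"] inD[OF H(2), of "H x"]] near[OF H] h(5) by simp
  qed (use N in auto)
qed

text \<open>If the values on the unit circle move by less than their distance from 0, the common
  value at the centre, then the image loops are homotopic in the punctured plane and have the same
  winding number.\<close>

lemma orient_pres_locally_constant:
  assumes H0: "H0 \<in> Homeo0"
  obtains N where "openin HomeoTop N" "H0 \<in> N" "\<And>H. H \<in> N \<Longrightarrow> H \<in> Homeo0"
    "\<And>H. H \<in> N \<Longrightarrow> orient_pres H \<longleftrightarrow> orient_pres H0"
proof -
  obtain G0 where G0: "homeomorphism UNIV UNIV H0 G0" "H0 0 = 0" using Homeo0_E[OF H0] by blast
  note h = homeomorphism_UNIV[OF G0(1)]
  have ne: "H0 u \<noteq> H0 p" if "dist p u = 1" for p u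
    using that h(3) by (metis dist_self injD zero_neq_one)
  obtain \<delta> where \<delta>: "\<delta> > 0" and gap: "\<And>p u. p \<in> {0} \<Longrightarrow> dist p u = 1 \<Longrightarrow> \<delta> \<le> dist (H0 u) (H0 p)"
    by (rule compact_dist_gap[OF h(1) compact_sing, of 0 1]) (rule ne, assumption, rule that)
  obtain N where N: "openin HomeoTop N" "H0 \<in> N" "\<And>H. H \<in> N \<Longrightarrow> H \<in> Homeo0"
      and near: "\<And>H x. H \<in> N \<Longrightarrow> x \<in> sphere 0 1 \<Longrightarrow> dist (H x) (H0 x) < \<delta>"
    by (rule HomeoTop_uniform_nbhd[OF H0 compact_sphere \<delta>]) (rule that)
  show ?thesis
  proof (rule that[OF N])
    fix H assume H: "H \<in> N"
    obtain G where G: "homeomorphism UNIV UNIV H G" "H 0 = 0" using Homeo0_E N(3)[OF H] by blast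
    note hh = homeomorphism_UNIV[OF G(1)]
    have "homotopic_loops (- {0}) (H0 \<circ> circle_loop 0 1) (H \<circ> circle_loop 0 1)"
    proof (rule homotopic_loops_nearby_explicit)
      fix t :: real and x :: complex assume "x \<notin> - {0}"
      moreover have "circle_loop 0 1 t \<in> sphere 0 1" by (simp add: circle_loop_def)
      ultimately show "norm ((H \<circ> circle_loop 0 1) t - (H0 \<circ> circle_loop 0 1) t)
          < norm ((H0 \<circ> circle_loop 0 1) t - x)"
        using near[OF H, of "circle_loop 0 1 t"] gap[of 0 "circle_loop 0 1 t"] G0(2)
        by (simp add: dist_norm)
    qed (auto intro: path_inj_circle_loop closed_inj_circle_loop h hh simp del: o_apply)
    then show "orient_pres H \<longleftrightarrow> orient_pres H0"
      using winding_number_homotopic_loops G0(2) G(2)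
        orient_pres_iff_winding_number[OF h(1,3)] orient_pres_iff_winding_number[OF hh(1,3)]
      by simp
  qed (use N in auto)
qed

text \<open>For the two values of \<open>b\<close> these sets form the open cover over which the
  action is pasted together.\<close>

lemma openin_orient_pres_eq: "openin HomeoTop {H \<in> Homeo0. orient_pres H = b}"
proof (subst openin_subopen, intro ballI)
  fix H0 assume H0: "H0 \<in> {H \<in> Homeo0. orient_pres H = b}"
  then have "H0 \<in> Homeo0" by simp
  then obtain N where N: "openin HomeoTop N" "H0 \<in> N" "\<And>H. H \<in> N \<Longrightarrow> H \<in> Homeo0"
      "\<And>H. H \<in> N \<Longrightarrow> orient_pres H \<longleftrightarrow> orient_pres H0"
    by (rule orient_pres_locally_constant) (rule that)
  have "N \<subseteq> {H \<in> Homeo0. orient_pres H = b}"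
  proof
    fix H assume H: "H \<in> N"
    show "H \<in> {H \<in> Homeo0. orient_pres H = b}"
      using N(3)[OF H] N(4)[OF H] H0 by simp
  qed
  with N(1,2) show "\<exists>T. openin HomeoTop T \<and> H0 \<in> T \<and> T \<subseteq> {H \<in> Homeo0. orient_pres H = b}"
    by blast
qed

lemma Homeo0_compose_cnj:
  assumes "H \<in> Homeo0"
  shows "H \<circ> cnj \<in> Homeo0"
proof -
  obtain G where "homeomorphism UNIV UNIV H G" "H 0 = 0" using Homeo0_E[OF assms] by blast
  then show ?thesis
    using homeomorphism_compose[OF homeomorphism_cnj, of UNIV H G] unfolding Homeo0_def by auto
qed

text \<open>Composition with \<open>cnj\<close> replaces the compact set in a subbasic condition by
  its mirror image.\<close>

lemma continuous_map_compose_cnj: "continuous_map HomeoTop HomeoTop (\<lambda>H. H \<circ> cnj)"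
proof -
  have "openin HomeoTop ((\<lambda>H. H \<circ> cnj) -` U \<inter> Homeo0)"
    if "U \<in> {Homeo0} \<union> {{H \<in> Homeo0. H ` K \<subseteq> V} | K V. compact K \<and> open V}" for U
  proof (cases "U = Homeo0")
    case True
    then have "(\<lambda>H. H \<circ> cnj) -` U \<inter> Homeo0 = topspace HomeoTop"
      using Homeo0_compose_cnj by auto
    then show ?thesis by (metis openin_topspace)
  next
    case False
    with that obtain K V where K: "compact K" "open V" "U = {H \<in> Homeo0. H ` K \<subseteq> V}" by auto
    then have "(\<lambda>H. H \<circ> cnj) -` U \<inter> Homeo0 = {H \<in> Homeo0. H ` (cnj ` K) \<subseteq> V}"
      using Homeo0_compose_cnj by (auto simp: image_comp)
    moreover have "compact (cnj ` K)" using K by (intro compact_continuous_image) auto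
    ultimately show ?thesis
      using K(2) unfolding HomeoTop_def by (intro topology_generated_by_Basis) blast
  qed
  then show ?thesis
    using Homeo0_compose_cnj unfolding HomeoTop_def continuous_on_generated_topo_iff
    by (fold HomeoTop_def) auto
qed


subsection \<open>Action on isomorphism classes\<close>

lemma pointed_lh_compose:
  assumes "H \<in> Homeo0" "orient_pres H" "pointed_lh \<phi>"
  shows "pointed_lh (H \<circ> \<phi>)"
proof -
  obtain G where G: "homeomorphism UNIV UNIV H G" "H 0 = 0" using Homeo0_E[OF assms(1)] by blast
  note h = homeomorphism_UNIV[OF G(1)]
  show ?thesis
    using assms(3) orient_pres_compose[OF h(1,3) assms(2)] local_homeo_compose[OF local_homeo_homeomorphism[OF G(1)]] G(2)
    unfolding pointed_lh_def by auto
qed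

lemma pointed_lh_cnj_conj:
  assumes "pointed_lh \<phi>"
  shows "pointed_lh (cnj \<circ> \<phi> \<circ> cnj)"
  using assms orient_pres_cnj_conj[of \<phi>] local_homeo_homeomorphism[OF homeomorphism_cnj]
  unfolding pointed_lh_def by (auto intro!: local_homeo_compose)

lemma op_homeo0_cnj_conj:
  assumes "op_homeo0 h g"
  shows "op_homeo0 (cnj \<circ> h \<circ> cnj) (cnj \<circ> g \<circ> cnj)"
proof -
  have "homeomorphism UNIV UNIV (cnj \<circ> (h \<circ> cnj)) ((cnj \<circ> g) \<circ> cnj)"
    using assms unfolding op_homeo0_def
    by (intro homeomorphism_compose[where T = UNIV] homeomorphism_cnj) auto
  then show ?thesis
    using assms orient_pres_cnj_conj[of h] unfolding op_homeo0_def by (auto simp: comp_assoc)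
qed

lemma op_homeo0_id: "op_homeo0 (\<lambda>x. x) (\<lambda>x. x)"
  by (auto simp: op_homeo0_def orient_pres_id intro: homeomorphismI)

lemma op_homeo0_inverse_0:
  assumes "op_homeo0 h g"
  shows "g 0 = 0"
  using assms homeomorphism_UNIV(5)[of h g 0] by (simp add: op_homeo0_def)

lemma self_in_Ecl: "pointed_lh \<phi> \<Longrightarrow> (\<phi>, y) \<in> Ecl \<phi> y"
  unfolding Ecl_def using op_homeo0_id by (auto simp: comp_def)

lemma Ecl_E:
  assumes "(\<psi>, z) \<in> Ecl \<phi> y"
  obtains h g where "op_homeo0 h g" "pointed_lh \<psi>" "\<psi> = \<phi> \<circ> g" "z = h y"
  using assms unfolding Ecl_def by blast

lemma Ecl_I: "pointed_lh (\<phi> \<circ> g) \<Longrightarrow> op_homeo0 h g \<Longrightarrow> (\<phi> \<circ> g, h y) \<in> Ecl \<phi> y"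
  unfolding Ecl_def by blast

lemma piE_Ecl: "piE (Ecl \<phi> y) = Mclass \<phi>"
  unfolding piE_def Ecl_def Mclass_def by blast

lemma piE_eq_image: "piE E = fst ` E"
  unfolding piE_def by force

lemma self_in_Mclass: "pointed_lh \<phi> \<Longrightarrow> \<phi> \<in> Mclass \<phi>"
  using self_in_Ecl[of \<phi> 0] piE_Ecl[of \<phi> 0] unfolding piE_def by blast

lemma Mt_E:
  assumes "P \<in> Mt"
  obtains \<phi> where "pointed_lh \<phi>" "P = Mclass \<phi>"
  using assms unfolding Mt_def by blast

lemma Et_E:
  assumes "E \<in> Et"
  obtains \<phi> y where "pointed_lh \<phi>" "E = Ecl \<phi> y"
  using assms unfolding Et_def by blast

lemma Mclass_in_Mt: "pointed_lh \<phi> \<Longrightarrow> Mclass \<phi> \<in> Mt"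
  unfolding Mt_def by blast

lemma Ecl_in_Et: "pointed_lh \<phi> \<Longrightarrow> Ecl \<phi> y \<in> Et"
  unfolding Et_def by blast

text \<open>Composition with \<open>H\<close> on the left commutes with reparametrisation on the
  right, so the image of a class lies in a class. It is the whole class because the inverse
  \<open>G\<close> also preserves orientation and undoes the action.\<close>

lemma actE_Ecl:
  assumes H: "H \<in> Homeo0" "orient_pres H" and \<phi>: "pointed_lh \<phi>"
  shows "actE H (Ecl \<phi> y) = Ecl (H \<circ> \<phi>) y"
proof -
  obtain G where G: "homeomorphism UNIV UNIV H G" "H 0 = 0" "G 0 = 0" using Homeo0_E[OF H(1)] by blast
  have G': "G \<in> Homeo0" "orient_pres G"
    using G homeomorphism_symD[OF G(1)] orient_pres_inverse[OF G(1) H(2)] unfolding Homeo0_def by auto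
  have GH: "G \<circ> (H \<circ> f) = f" "H \<circ> (G \<circ> f) = f" for f :: "complex \<Rightarrow> complex"
    using homeomorphism_UNIV(5,6)[OF G(1)] by auto
  have "(\<lambda>(\<phi>, y). (H \<circ> \<phi>, y)) ` Ecl \<phi> y = Ecl (H \<circ> \<phi>) y"
  proof (intro equalityI subrelI subsetI)
    fix a assume "a \<in> (\<lambda>(\<phi>, y). (H \<circ> \<phi>, y)) ` Ecl \<phi> y"
    then obtain \<psi> z where a: "a = (H \<circ> \<psi>, z)" "(\<psi>, z) \<in> Ecl \<phi> y" by auto
    from a(2) obtain h g where hg: "op_homeo0 h g" "pointed_lh \<psi>" "\<psi> = \<phi> \<circ> g" "z = h y"
      by (rule Ecl_E)
    have "pointed_lh (H \<circ> \<phi> \<circ> g)" using pointed_lh_compose[OF H hg(2)] hg(3) by (simp add: comp_assoc)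
    from Ecl_I[OF this hg(1)] show "a \<in> Ecl (H \<circ> \<phi>) y" using a(1) hg(3,4) by (simp add: comp_assoc)
  next
    fix \<psi> z assume "(\<psi>, z) \<in> Ecl (H \<circ> \<phi>) y"
    then obtain h g where hg: "op_homeo0 h g" "pointed_lh \<psi>" "\<psi> = H \<circ> \<phi> \<circ> g" "z = h y"
      by (rule Ecl_E)
    have eq: "G \<circ> \<psi> = \<phi> \<circ> g" using hg(3) GH(1) by (simp add: comp_assoc)
    have "pointed_lh (\<phi> \<circ> g)" using pointed_lh_compose[OF G' hg(2)] eq by simp
    then have "(G \<circ> \<psi>, z) \<in> Ecl \<phi> y" unfolding eq hg(4) by (rule Ecl_I[OF _ hg(1)])
    then show "(\<psi>, z) \<in> (\<lambda>(\<phi>, y). (H \<circ> \<phi>, y)) ` Ecl \<phi> y"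
      by (rule rev_image_eqI) (simp add: GH)
  qed
  then show ?thesis using H(2) by (simp add: actE_def)
qed

lemma piE_actE: "piE (actE H E) = actM H (piE E)"
  by (simp add: piE_eq_image actE_def actM_def image_image case_prod_unfold)

lemma actM_Mclass:
  assumes "H \<in> Homeo0" "orient_pres H" "pointed_lh \<phi>"
  shows "actM H (Mclass \<phi>) = Mclass (H \<circ> \<phi>)"
  using actE_Ecl[OF assms, of 0] piE_actE[of H "Ecl \<phi> 0"] by (simp add: piE_Ecl)

section \<open>Conjugation of classes by the reflection \<open>cnj\<close>\<close>

definition conjE :: "((complex \<Rightarrow> complex) \<times> complex) set \<Rightarrow> ((complex \<Rightarrow> complex) \<times> complex) set" where
  "conjE E = (\<lambda>(\<phi>, y). (cnj \<circ> \<phi> \<circ> cnj, cnj y)) ` E"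

definition conjM :: "(complex \<Rightarrow> complex) set \<Rightarrow> (complex \<Rightarrow> complex) set" where
  "conjM P = (\<lambda>\<phi>. cnj \<circ> \<phi> \<circ> cnj) ` P"

lemma cnj_conj_involutive [simp]: "cnj \<circ> (cnj \<circ> f \<circ> cnj) \<circ> cnj = f" for f :: "complex \<Rightarrow> complex"
  by auto

text \<open>Conjugation by \<open>cnj\<close> is an involution, so one inclusion, proved for all
  classes, also yields the other.\<close>

lemma conjE_Ecl:
  assumes \<phi>: "pointed_lh \<phi>"
  shows "conjE (Ecl \<phi> y) = Ecl (cnj \<circ> \<phi> \<circ> cnj) (cnj y)"
proof -
  have sub: "(cnj \<circ> \<psi> \<circ> cnj, cnj z) \<in> Ecl (cnj \<circ> \<phi> \<circ> cnj) (cnj y)" if el: "(\<psi>, z) \<in> Ecl \<phi> y" for \<phi> y \<psi> z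
  proof -
    obtain h g where hg: "op_homeo0 h g" "pointed_lh \<psi>" "\<psi> = \<phi> \<circ> g" "z = h y"
      using el by (rule Ecl_E)
    have eq: "cnj \<circ> \<psi> \<circ> cnj = (cnj \<circ> \<phi> \<circ> cnj) \<circ> (cnj \<circ> g \<circ> cnj)" "cnj z = (cnj \<circ> h \<circ> cnj) (cnj y)"
      using hg by auto
    show ?thesis
      using pointed_lh_cnj_conj[OF hg(2)] op_homeo0_cnj_conj[OF hg(1)] unfolding eq by (rule Ecl_I)
  qed
  show ?thesis
  proof (rule equalityI)
    show "conjE (Ecl \<phi> y) \<subseteq> Ecl (cnj \<circ> \<phi> \<circ> cnj) (cnj y)"
      using sub unfolding conjE_def by auto
    show "Ecl (cnj \<circ> \<phi> \<circ> cnj) (cnj y) \<subseteq> conjE (Ecl \<phi> y)"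
    proof (rule subrelI)
      fix \<psi> z assume "(\<psi>, z) \<in> Ecl (cnj \<circ> \<phi> \<circ> cnj) (cnj y)"
      from sub[OF this] have "(cnj \<circ> \<psi> \<circ> cnj, cnj z) \<in> Ecl \<phi> y" by simp
      then show "(\<psi>, z) \<in> conjE (Ecl \<phi> y)"
        unfolding conjE_def by (rule rev_image_eqI) simp
    qed
  qed
qed

lemma piE_conjE: "piE (conjE E) = conjM (piE E)"
  by (simp add: piE_eq_image conjE_def conjM_def image_image case_prod_unfold)

lemma conjM_Mclass: "pointed_lh \<phi> \<Longrightarrow> conjM (Mclass \<phi>) = Mclass (cnj \<circ> \<phi> \<circ> cnj)"
  using conjE_Ecl[of \<phi> 0] piE_conjE[of "Ecl \<phi> 0"] by (simp add: piE_Ecl)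

lemma act_reversing:
  assumes "H \<in> Homeo0" "\<not> orient_pres H"
  shows "actE H E = actE (H \<circ> cnj) (conjE E)" "actM H P = actM (H \<circ> cnj) (conjM P)"
proof -
  obtain G where "homeomorphism UNIV UNIV H G" using Homeo0_E[OF assms(1)] by blast
  from orient_pres_compose_cnj[OF this assms(2)] have o: "orient_pres (H \<circ> cnj)" .
  have eq: "H \<circ> cnj \<circ> (cnj \<circ> f \<circ> cnj) = H \<circ> f \<circ> cnj" for f :: "complex \<Rightarrow> complex"
    by auto
  show "actE H E = actE (H \<circ> cnj) (conjE E)"
    using assms(2) o unfolding actE_def conjE_def by (simp only: if_True if_False image_image case_prod_unfold eq fst_conv snd_conv)
  show "actM H P = actM (H \<circ> cnj) (conjM P)"
    using assms(2) o unfolding actM_def conjM_def by (simp only: if_True if_False image_image eq)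
qed

subsection \<open>Immersions\<close>

lemma immersion_reparam:
  assumes "immersion \<phi> K (\<psi> \<circ> g) \<iota>" "continuous_on UNIV g" "g 0 = 0"
  shows "immersion \<phi> K \<psi> (g \<circ> \<iota>)"
  using assms unfolding immersion_def
  by (auto intro: continuous_on_compose2[of UNIV])

text \<open>An immersion into one representative becomes an immersion into any other by composing
  with the reparametrisation. This lets the later arguments work with a single developing
  map.\<close>

lemma Ecl_in_Eplus_iff:
  assumes \<psi>: "pointed_lh \<psi>"
  shows "Ecl \<psi> y \<in> Eplus \<phi> K U \<longleftrightarrow> (\<exists>\<iota>. immersion \<phi> K \<psi> \<iota> \<and> y \<in> \<iota> ` U)"
proof
  assume "Ecl \<psi> y \<in> Eplus \<phi> K U"
  then obtain \<zeta> z \<iota> where el: "(\<zeta>, z) \<in> Ecl \<psi> y" and i: "immersion \<phi> K \<zeta> \<iota>" "z \<in> \<iota> ` U"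
    unfolding Eplus_def by blast
  obtain h g where hg: "op_homeo0 h g" "\<zeta> = \<psi> \<circ> g" "z = h y" using el by (rule Ecl_E)
  have hom: "homeomorphism UNIV UNIV h g" using hg(1) by (simp add: op_homeo0_def)
  have "immersion \<phi> K \<psi> (g \<circ> \<iota>)"
    using i(1) hg(2) homeomorphism_UNIV(2)[OF hom] op_homeo0_inverse_0[OF hg(1)]
    by (auto intro: immersion_reparam)
  moreover have "y \<in> (g \<circ> \<iota>) ` U"
    using i(2) hg(3) homeomorphism_UNIV(5)[OF hom] by (metis image_comp imageI)
  ultimately show "\<exists>\<iota>. immersion \<phi> K \<psi> \<iota> \<and> y \<in> \<iota> ` U" by blast
next
  assume "\<exists>\<iota>. immersion \<phi> K \<psi> \<iota> \<and> y \<in> \<iota> ` U"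
  then show "Ecl \<psi> y \<in> Eplus \<phi> K U"
    unfolding Eplus_def using self_in_Ecl[OF \<psi>] Ecl_in_Et[OF \<psi>] by blast
qed

lemma Mclass_E:
  assumes "\<zeta> \<in> Mclass \<psi>"
  obtains h g where "op_homeo0 h g" "\<zeta> = \<psi> \<circ> g" "continuous_on UNIV g" "inj g" "g 0 = 0"
proof -
  obtain h g where hg: "op_homeo0 h g" "\<zeta> = \<psi> \<circ> g" using assms unfolding Mclass_def by blast
  then have "homeomorphism UNIV UNIV h g" by (simp add: op_homeo0_def)
  from that[OF hg homeomorphism_UNIV(2,4)[OF this] op_homeo0_inverse_0[OF hg(1)]] show ?thesis .
qed

lemma Mclass_immersion_iff:
  assumes \<psi>: "pointed_lh \<psi>"
  shows "(\<exists>\<zeta>\<in>Mclass \<psi>. \<exists>\<iota>. immersion \<phi> K \<zeta> \<iota>) \<longleftrightarrow> (\<exists>\<iota>. immersion \<phi> K \<psi> \<iota>)"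
proof
  assume "\<exists>\<zeta>\<in>Mclass \<psi>. \<exists>\<iota>. immersion \<phi> K \<zeta> \<iota>"
  then obtain \<zeta> \<iota> where \<zeta>: "\<zeta> \<in> Mclass \<psi>" "immersion \<phi> K \<zeta> \<iota>" by blast
  from \<zeta>(1) obtain h g where "\<zeta> = \<psi> \<circ> g" "continuous_on UNIV g" "g 0 = 0" by (rule Mclass_E)
  with \<zeta>(2) show "\<exists>\<iota>. immersion \<phi> K \<psi> \<iota>" using immersion_reparam by blast
qed (use self_in_Mclass[OF \<psi>] in blast)

lemma Mclass_embedding_iff:
  assumes \<psi>: "pointed_lh \<psi>"
  shows "(\<exists>\<zeta>\<in>Mclass \<psi>. \<exists>\<iota>. embedding \<phi> K \<zeta> \<iota>) \<longleftrightarrow> (\<exists>\<iota>. embedding \<phi> K \<psi> \<iota>)"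
proof
  assume "\<exists>\<zeta>\<in>Mclass \<psi>. \<exists>\<iota>. embedding \<phi> K \<zeta> \<iota>"
  then obtain \<zeta> \<iota> where \<zeta>: "\<zeta> \<in> Mclass \<psi>" "immersion \<phi> K \<zeta> \<iota>" "inj_on \<iota> K"
    unfolding embedding_def by blast
  from \<zeta>(1) obtain h g where "\<zeta> = \<psi> \<circ> g" "continuous_on UNIV g" "inj g" "g 0 = 0" by (rule Mclass_E)
  with \<zeta>(2,3) have "embedding \<phi> K \<psi> (g \<circ> \<iota>)"
    unfolding embedding_def using immersion_reparam
    by (blast intro: comp_inj_on inj_on_subset)
  then show "\<exists>\<iota>. embedding \<phi> K \<psi> \<iota>" by blast
qed (use self_in_Mclass[OF \<psi>] in blast)

lemma immersion_cnj_conj: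
  "immersion (cnj \<circ> \<phi> \<circ> cnj) (cnj ` K) (cnj \<circ> \<psi> \<circ> cnj) (cnj \<circ> \<iota> \<circ> cnj) \<longleftrightarrow> immersion \<phi> K \<psi> \<iota>"
proof -
  have *: "immersion (cnj \<circ> \<phi> \<circ> cnj) (cnj ` K) (cnj \<circ> \<psi> \<circ> cnj) (cnj \<circ> \<iota> \<circ> cnj)"
    if "immersion \<phi> K \<psi> \<iota>" for \<phi> K \<psi> \<iota>
    using that unfolding immersion_def
    by (auto simp: image_comp comp_def intro!: continuous_on_cnj continuous_on_compose2[of K \<iota> "cnj ` K" cnj])
  \<comment> \<open>The converse is the same implication applied to the conjugated data.\<close>
  from *[of \<phi> K \<psi> \<iota>] *[of "cnj \<circ> \<phi> \<circ> cnj" "cnj ` K" "cnj \<circ> \<psi> \<circ> cnj" "cnj \<circ> \<iota> \<circ> cnj"]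
  show ?thesis by (auto simp: image_comp comp_def)
qed

lemma embedding_cnj_conj:
  "embedding (cnj \<circ> \<phi> \<circ> cnj) (cnj ` K) (cnj \<circ> \<psi> \<circ> cnj) (cnj \<circ> \<iota> \<circ> cnj) \<longleftrightarrow> embedding \<phi> K \<psi> \<iota>"
  unfolding embedding_def immersion_cnj_conj by (auto simp: inj_on_def)

text \<open>Since \<open>\<phi>\<close> factors through \<open>\<iota>\<close>, local injectivity of
  \<open>\<phi>\<close> passes to \<open>\<iota>\<close>, and invariance of domain applies.\<close>

lemma immersion_open_image:
  fixes \<iota> :: "complex \<Rightarrow> complex"
  assumes "local_homeo \<phi>" "open U" "continuous_on U \<iota>" "\<And>a. a \<in> U \<Longrightarrow> \<zeta> (\<iota> a) = \<phi> a"
  shows "open (\<iota> ` U)"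
proof (subst open_subopen, clarify)
  fix a assume a: "a \<in> U"
  obtain V where V: "open V" "a \<in> V" "inj_on \<phi> V"
    using assms(1) unfolding local_homeo_iff by blast
  have "inj_on \<iota> (U \<inter> V)"
    using V(3) assms(4) by (intro inj_onI) (metis IntE inj_onD)
  then have "open (\<iota> ` (U \<inter> V))"
    using assms(2,3) V(1) by (intro invariance_of_domain) (auto intro: continuous_on_subset)
  with a V(2) show "\<exists>T. open T \<and> \<iota> a \<in> T \<and> T \<subseteq> \<iota> ` U"
    by (intro exI[of _ "\<iota> ` (U \<inter> V)"]) auto
qed

text \<open>Uniqueness of lifts: the set of agreement is closed, is open because
  \<open>\<zeta>\<close> is injective near a common value, and contains the basepoint.\<close>

lemma immersion_unique:
  assumes \<zeta>: "local_homeo \<zeta>" and A: "connected A" "0 \<in> A"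
    and i: "immersion \<phi> A \<zeta> \<iota>1" "immersion \<phi> A \<zeta> \<iota>2" and a: "a \<in> A"
  shows "\<iota>1 a = \<iota>2 a"
proof -
  let ?S = "{x \<in> A. \<iota>1 x = \<iota>2 x}"
  have c: "continuous_on A \<iota>1" "continuous_on A \<iota>2" using i unfolding immersion_def by auto
  have "closedin (top_of_set A) {x \<in> A. \<iota>1 x - \<iota>2 x = 0}"
    by (intro continuous_closedin_preimage_constant continuous_intros c)
  then have cl: "closedin (top_of_set A) ?S" by simp
  have "openin (top_of_set A) ?S"
  proof (subst openin_subopen, clarify)
    fix x assume x: "x \<in> A" "\<iota>1 x = \<iota>2 x"
    obtain W where W: "open W" "\<iota>1 x \<in> W" "inj_on \<zeta> W"
      using \<zeta> unfolding local_homeo_iff by blast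
    let ?T = "(A \<inter> \<iota>1 -` W) \<inter> (A \<inter> \<iota>2 -` W)"
    have "openin (top_of_set A) ?T"
      by (intro openin_Int continuous_openin_preimage_gen c W)
    moreover have "?T \<subseteq> ?S"
      using i W(3) unfolding immersion_def by (auto intro: inj_onD)
    moreover have "x \<in> ?T" using x W(2) by simp
    ultimately show "\<exists>T. openin (top_of_set A) T \<and> x \<in> T \<and> T \<subseteq> ?S" by blast
  qed
  with cl A(1) have "?S = {} \<or> ?S = A" unfolding connected_clopen by blast
  moreover have "0 \<in> ?S" using A(2) i unfolding immersion_def by simp
  ultimately show ?thesis using a by blast
qed


text \<open>Used contrapositively: a failure to embed \<open>U\<close> already occurs on a smaller
  concentric disk with compact closure in \<open>U\<close>. By uniqueness, embeddings of the
  concentric disks agree and glue. Any two points lie in a common disk, which gives injectivity of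
  the union.\<close>

lemma embedding_exhaustion:
  assumes \<zeta>: "local_homeo \<zeta>" and fg: "homeomorphism (ball (0::complex) 1) U f g" and U: "0 \<in> U"
    and emb: "\<And>s. norm (g 0) < s \<Longrightarrow> s < 1 \<Longrightarrow> \<exists>\<iota>. embedding \<phi> (f ` ball 0 s) \<zeta> \<iota>"
  shows "\<exists>\<iota>. embedding \<phi> U \<zeta> \<iota>"
proof -
  have f: "continuous_on (ball 0 1) f" "f ` ball 0 1 = U" "inj_on f (ball 0 1)"
    and g: "g ` U = ball 0 1" "\<And>x. x \<in> U \<Longrightarrow> f (g x) = x" "\<And>w. w \<in> ball 0 1 \<Longrightarrow> g (f w) = w"
    using fg unfolding homeomorphism_def by (auto intro: inj_on_inverseI)
  have mem: "x \<in> f ` ball 0 s" if "x \<in> U" "norm (g x) < s" for x s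
    using that g(2) by (metis imageI mem_ball_0)
  have sub: "f ` ball 0 s \<subseteq> U" if "s < 1" for s
    using that f(2) by auto
  have op: "open (f ` ball 0 s)" if "s < 1" for s
    using that f by (intro invariance_of_domain) (auto intro: continuous_on_subset inj_on_subset)
  have con: "connected (f ` ball 0 s)" if "s < 1" for s
    using that f by (intro connected_continuous_image) (auto intro: continuous_on_subset)
  \<comment> \<open>The chart \<open>f\<close> may send another point than 0 to the basepoint. Radii
    above \<open>norm (g 0)\<close> are those whose disks contain it.\<close>
  let ?I = "{norm (g 0)<..<1}"
  have "\<forall>s\<in>?I. \<exists>\<iota>. embedding \<phi> (f ` ball 0 s) \<zeta> \<iota>"
    using emb by simp
  from bchoice[OF this] obtain \<iota> where "\<forall>s\<in>?I. embedding \<phi> (f ` ball 0 s) \<zeta> (\<iota> s)" ..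
  note \<iota> = bspec[OF this]
  have agree': "\<iota> s x = \<iota> t x" if "s \<in> ?I" "t \<in> ?I" "s \<le> t" "x \<in> f ` ball 0 s" for s t x
  proof (rule immersion_unique[where A = "f ` ball 0 s" and \<phi> = \<phi> and ?\<iota>1.0 = "\<iota> s" and ?\<iota>2.0 = "\<iota> t", OF \<zeta> con])
    show "0 \<in> f ` ball 0 s" using mem[OF U] that(1) by simp
    show "immersion \<phi> (f ` ball 0 s) \<zeta> (\<iota> s)"
      using \<iota>[OF that(1)] by (simp add: embedding_def)
    have "f ` ball 0 s \<subseteq> f ` ball 0 t" using that(3) by auto
    then show "immersion \<phi> (f ` ball 0 s) \<zeta> (\<iota> t)"
      using \<iota>[OF that(2)] unfolding embedding_def immersion_def by (blast intro: continuous_on_subset)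
  qed (use that in auto)
  have agree: "\<iota> s x = \<iota> t x" if "s \<in> ?I" "t \<in> ?I" "x \<in> f ` ball 0 s" "x \<in> f ` ball 0 t" for s t x
  proof (cases "s \<le> t")
    case True
    show ?thesis by (rule agree'[OF that(1,2) True that(3)])
  next
    case False
    then show ?thesis by (intro agree'[OF that(2,1) _ that(4), symmetric]) simp
  qed
  \<comment> \<open>Halfway between 1 and the larger norm: an admissible radius whose disk contains
    \<open>x\<close>.\<close>
  define r where "r x = (max (norm (g x)) (norm (g 0)) + 1) / 2" for x
  have less1: "norm (g x) < 1" if "x \<in> U" for x using g(1) that by (metis imageI mem_ball_0)
  have r: "r x \<in> ?I" "norm (g x) < r x" if "x \<in> U" for x
    using less1[OF that] less1[OF U] unfolding r_def by auto
  define \<kappa> where "\<kappa> x = \<iota> (r x) x" for x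
  have \<kappa>: "\<kappa> x = \<iota> s x" if "s \<in> ?I" "x \<in> f ` ball 0 s" for s x
  proof -
    have "x \<in> U" using that sub[of s] by auto
    then show ?thesis
      unfolding \<kappa>_def by (intro agree[OF r(1) that(1) mem[OF _ r(2)] that(2)])
  qed
  have "continuous_on (\<Union>s\<in>?I. f ` ball 0 s) \<kappa>"
  proof (rule continuous_on_open_UN)
    fix s assume s: "s \<in> ?I"
    then show "open (f ` ball 0 s)" by (intro op) auto
    have "continuous_on (f ` ball 0 s) (\<iota> s)"
      using \<iota>[OF s] unfolding embedding_def immersion_def by blast
    then show "continuous_on (f ` ball 0 s) \<kappa>"
      by (rule continuous_on_eq) (use \<kappa>[OF s] in auto)
  qed
  moreover have "U \<subseteq> (\<Union>s\<in>?I. f ` ball 0 s)"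
  proof
    fix x assume x: "x \<in> U"
    show "x \<in> (\<Union>s\<in>?I. f ` ball 0 s)"
      using mem[OF x r(2)[OF x]] by (rule UN_I[OF r(1)[OF x]])
  qed
  ultimately have "continuous_on U \<kappa>" by (rule continuous_on_subset)
  moreover have "\<kappa> 0 = 0"
    using \<iota>[OF r(1)[OF U]] unfolding \<kappa>_def embedding_def immersion_def by blast
  moreover have "\<zeta> (\<kappa> x) = \<phi> x" if "x \<in> U" for x
    using \<iota>[OF r(1)[OF that]] mem[OF that r(2)[OF that]] unfolding \<kappa>_def embedding_def immersion_def by blast
  moreover have "inj_on \<kappa> U"
  proof (rule inj_onI)
    fix x y assume xy: "x \<in> U" "y \<in> U" "\<kappa> x = \<kappa> y"
    define s where "s = max (r x) (r y)"
    have s: "s \<in> ?I" using r[OF xy(1)] r[OF xy(2)] unfolding s_def by (auto simp: max_def)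
    have m: "x \<in> f ` ball 0 s" "y \<in> f ` ball 0 s"
      using r[OF xy(1)] r[OF xy(2)] xy by (auto simp: s_def intro!: mem)
    have "\<iota> s x = \<iota> s y" using \<kappa>[OF s m(1)] \<kappa>[OF s m(2)] xy(3) by simp
    with \<iota>[OF s] m show "x = y" unfolding embedding_def by (auto dest: inj_onD)
  qed
  ultimately have "embedding \<phi> U \<zeta> \<kappa>" unfolding embedding_def immersion_def by blast
  then show ?thesis by blast
qed

text \<open>Serves both moduli spaces. Existence of \<open>\<kappa>'\<close> keeps the surface in
  the prescribed set, and the inclusion keeps a marked point from the image of \<open>V\<close>
  inside the image of \<open>U\<close>. The data \<open>N\<close>, \<open>R\<close>,
  \<open>V\<close> are fixed before \<open>H\<close> and \<open>\<zeta>\<close>.\<close>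

lemma immersion_nearby:
  assumes H0: "H0 \<in> Homeo0" and \<phi>: "pointed_lh \<phi>" and \<psi>: "pointed_lh \<psi>"
    and K: "compact K" "0 \<in> K" and U: "open U" "U \<subseteq> K" "u \<in> U"
    and i: "immersion \<phi> K (H0 \<circ> \<psi>) \<iota>"
  obtains N R V where "openin HomeoTop N" "H0 \<in> N" "R > 0" "open V" "V \<subseteq> ball 0 R" "\<iota> u \<in> V"
    "\<And>H \<zeta> \<kappa>. H \<in> N \<Longrightarrow> immersion \<psi> (cball 0 R) \<zeta> \<kappa> \<Longrightarrow>
       \<exists>\<kappa>'. immersion \<phi> K (H \<circ> \<zeta>) \<kappa>' \<and> \<kappa> ` V \<subseteq> \<kappa>' ` U"
proof -
  have \<psi>': "local_homeo \<psi>" "\<psi> 0 = 0" using \<psi> unfolding pointed_lh_def by auto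
  have cont: "continuous_on A \<psi>" for A
    using \<psi>'(1) continuous_on_subset unfolding local_homeo_iff by blast
  have ii: "continuous_on K \<iota>" "\<iota> 0 = 0" "\<And>a. a \<in> K \<Longrightarrow> H0 (\<psi> (\<iota> a)) = \<phi> a"
    using i unfolding immersion_def by auto
  obtain R0 where R0: "R0 > 0" "\<iota> ` K \<subseteq> ball 0 R0"
    using bounded_subset_ballD[OF compact_imp_bounded[OF compact_continuous_image[OF ii(1) K(1)]]] by blast
  have "open (\<iota> ` U)"
  proof (rule immersion_open_image[where \<phi> = \<phi> and \<zeta> = "H0 \<circ> \<psi>"])
    show "local_homeo \<phi>" using \<phi> unfolding pointed_lh_def by blast
  qed (use U ii in \<open>auto intro: continuous_on_subset\<close>)
  then obtain r where r: "r > 0" "cball (\<iota> u) r \<subseteq> \<iota> ` U"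
    using U(3) unfolding open_contains_cball by blast
  define C where "C = cball (0::complex) R0"
  have C: "compact C" "0 \<in> C" "\<iota> ` K \<subseteq> C" "cball (\<iota> u) r \<subseteq> C"
    using R0(1) subset_trans[OF R0(2) ball_subset_cball] subset_trans[OF r(2) subset_trans[OF image_mono[OF U(2)]]]
    by (auto simp: C_def)
  \<comment> \<open>At most 1 so that \<open>T\<close> maps \<open>C\<close> into the disk of radius
    \<open>R0 + 1\<close> on which \<open>\<kappa>\<close> is defined, and at most
    \<open>r / 8\<close> so that \<open>T\<close> of the \<open>r\<close>-ball around
    \<open>\<iota> u\<close> still covers \<open>V\<close>.\<close>
  define \<eta> where "\<eta> = min 1 (r / 8)"
  have \<eta>: "\<eta> > 0" "\<eta> \<le> 1" "\<eta> \<le> r / 8" using r(1) by (auto simp: \<eta>_def)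
  obtain \<epsilon> where \<epsilon>: "\<epsilon> > 0" and lift:
    "\<And>G. continuous_on (\<psi> ` C) G \<Longrightarrow> inj_on G (\<psi> ` C) \<Longrightarrow>
        \<forall>p\<in>C. dist (G (\<psi> p)) (\<psi> p) < \<epsilon> \<Longrightarrow>
        \<exists>T. continuous_on C T \<and> inj_on T C \<and>
          (\<forall>p\<in>C. dist (T p) p < \<eta> \<and> \<psi> (T p) = G (\<psi> p) \<and> (G (\<psi> p) = \<psi> p \<longrightarrow> T p = p))"
    by (rule local_homeo_lift_near_identity[OF \<psi>'(1) C(1) \<eta>(1)]) (rule that)
  have cC: "compact (\<psi> ` C)" using C(1) cont by (intro compact_continuous_image)
  obtain N where N: "openin HomeoTop N" "H0 \<in> N" "\<And>H. H \<in> N \<Longrightarrow> H \<in> Homeo0"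
    and near: "\<And>H G x. H \<in> N \<Longrightarrow> homeomorphism UNIV UNIV H G \<Longrightarrow> x \<in> \<psi> ` C \<Longrightarrow> dist (G (H0 x)) x < \<epsilon>"
    by (rule HomeoTop_inverse_nbhd[OF H0 cC \<epsilon>]) (rule that)
  obtain G0 where G0: "homeomorphism UNIV UNIV H0 G0" "H0 0 = 0" using Homeo0_E[OF H0] by blast
  note h0 = homeomorphism_UNIV[OF G0(1)]
  define V where "V = ball (\<iota> u) (r / 2)"
  have VC: "V \<subseteq> cball (\<iota> u) r" using r(1) by (auto simp: V_def)
  show ?thesis
  proof (rule that[of N "R0 + 1" V])
    show "V \<subseteq> ball 0 (R0 + 1)" using VC C(4) unfolding C_def by fastforce
    fix H \<zeta> \<kappa> assume H: "H \<in> N" and \<kappa>: "immersion \<psi> (cball 0 (R0 + 1)) \<zeta> \<kappa>"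
    obtain G where G: "homeomorphism UNIV UNIV H G" "G 0 = 0" using Homeo0_E[OF N(3)[OF H]] by blast
    note h = homeomorphism_UNIV[OF G(1)]
    have "\<exists>T. continuous_on C T \<and> inj_on T C \<and>
          (\<forall>p\<in>C. dist (T p) p < \<eta> \<and> \<psi> (T p) = (G \<circ> H0) (\<psi> p) \<and> ((G \<circ> H0) (\<psi> p) = \<psi> p \<longrightarrow> T p = p))"
    proof (rule lift)
      show "continuous_on (\<psi> ` C) (G \<circ> H0)" by (intro continuous_on_compose h h0)
      show "inj_on (G \<circ> H0) (\<psi> ` C)"
        using inj_compose[OF h(4) h0(3)] by (rule inj_on_subset) simp
    qed (use near[OF H G(1)] in auto)
    then obtain T where T: "continuous_on C T" "inj_on T C"
      "\<And>p. p \<in> C \<Longrightarrow> dist (T p) p < \<eta>" "\<And>p. p \<in> C \<Longrightarrow> \<psi> (T p) = G (H0 (\<psi> p))"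
      "\<And>p. p \<in> C \<Longrightarrow> G (H0 (\<psi> p)) = \<psi> p \<Longrightarrow> T p = p" by auto
    have T0: "T 0 = 0" using T(5)[OF C(2)] \<psi>'(2) G0(2) G(2) by simp
    have TR: "T p \<in> cball 0 (R0 + 1)" if "p \<in> C" for p
    proof -
      have "norm (T p) \<le> norm p + dist (T p) p" by (simp add: dist_norm norm_triangle_sub)
      moreover have "norm p \<le> R0" using that by (simp add: C_def)
      ultimately show ?thesis using T(3)[OF that] \<eta>(2) by simp
    qed
    have k: "continuous_on (cball 0 (R0 + 1)) \<kappa>" "\<kappa> 0 = 0"
      "\<And>a. a \<in> cball 0 (R0 + 1) \<Longrightarrow> \<zeta> (\<kappa> a) = \<psi> a"
      using \<kappa> unfolding immersion_def by auto
    \<comment> \<open>The lift satisfies \<open>H (\<psi> (T p)) = H0 (\<psi> p)\<close>, so the new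
      developing map, evaluated along the composite, returns
      \<open>H0 (\<psi> (\<iota> a)) = \<phi> a\<close>.\<close>
    have "immersion \<phi> K (H \<circ> \<zeta>) (\<kappa> \<circ> (T \<circ> \<iota>))"
      unfolding immersion_def
    proof (intro conjI ballI)
      have "continuous_on K (T \<circ> \<iota>)"
        by (rule continuous_on_compose[OF ii(1) continuous_on_subset[OF T(1) C(3)]])
      then show "continuous_on K (\<kappa> \<circ> (T \<circ> \<iota>))"
        by (rule continuous_on_compose) (use TR C(3) in \<open>auto intro!: continuous_on_subset[OF k(1)]\<close>)
      show "(\<kappa> \<circ> (T \<circ> \<iota>)) 0 = 0" by (simp add: ii T0 k)
      fix a assume a: "a \<in> K"
      then have "\<iota> a \<in> C" using C(3) by blast
      then show "(H \<circ> \<zeta>) ((\<kappa> \<circ> (T \<circ> \<iota>)) a) = \<phi> a"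
        using k(3)[OF TR] T(4) h(6) ii(3)[OF a] by simp
    qed
    moreover have "V \<subseteq> T ` ball (\<iota> u) r"
    proof -
      let ?z = "\<iota> u"
      have zC: "?z \<in> C" using U C(3) by blast
      \<comment> \<open>Displacements below \<open>r / 8\<close> at the centre and on the sphere
        leave at least \<open>3 * r / 4\<close> between them. Since \<open>r / 2 + r / 8\<close> is
        smaller than this, \<open>V\<close> lies in the ball around the moved centre.\<close>
      have "ball (T ?z) (3 * r / 4) \<subseteq> T ` ball ?z r"
      proof (rule ball_subset_image_ball[OF continuous_on_subset[OF T(1) C(4)] _ r(1)])
        have "ball ?z r \<subseteq> C" using C(4) ball_subset_cball by blast
        then show "open (T ` ball ?z r)"
          by (intro invariance_of_domain continuous_on_subset[OF T(1)] inj_on_subset[OF T(2)]) auto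
        fix w assume w: "dist ?z w = r"
        then have "w \<in> C" using C(4) by auto
        then show "3 * r / 4 \<le> dist (T w) (T ?z)"
          using T(3)[of w] T(3)[OF zC] \<eta>(3) w dist_triangle[of ?z w "T ?z"] dist_triangle[of "T ?z" w "T w"]
          by (simp add: dist_commute)
      qed
      moreover have "V \<subseteq> ball (T ?z) (3 * r / 4)"
      proof
        fix w assume "w \<in> V"
        then show "w \<in> ball (T ?z) (3 * r / 4)"
          using T(3)[OF zC] \<eta>(3) r(1) dist_triangle[of "T ?z" w ?z] by (simp add: V_def)
      qed
      ultimately show ?thesis by blast
    qed
    then have "\<kappa> ` V \<subseteq> (\<kappa> \<circ> (T \<circ> \<iota>)) ` U"
      using r(2) ball_subset_cball[of "\<iota> u" r] by (fastforce simp: image_comp[symmetric])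
    ultimately show "\<exists>\<kappa>'. immersion \<phi> K (H \<circ> \<zeta>) \<kappa>' \<and> \<kappa> ` V \<subseteq> \<kappa>' ` U" by blast
  qed (use N R0 r in \<open>auto simp: V_def\<close>)
qed

text \<open>The obstruction for \<open>\<psi>\<close> is again of subbasic form, now for the smaller
  disk \<open>V\<close>. Shrinking \<open>U\<close> to \<open>V\<close> creates the margin in which
  \<open>T\<close> can move points without leaving \<open>U\<close>.\<close>

lemma no_embedding_nearby:
  assumes H0: "H0 \<in> Homeo0" "orient_pres H0" and \<phi>: "pointed_lh \<phi>" and \<psi>: "pointed_lh \<psi>"
    and U: "odisk U" and no: "\<nexists>\<iota>. embedding \<phi> U (H0 \<circ> \<psi>) \<iota>"
  obtains N \<phi>' V where "openin HomeoTop N" "H0 \<in> N" "pointed_lh \<phi>'" "odisk V"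
    "\<nexists>\<iota>. embedding \<phi>' V \<psi> \<iota>"
    "\<And>H \<zeta>. H \<in> N \<Longrightarrow> \<nexists>\<iota>. embedding \<phi>' V \<zeta> \<iota> \<Longrightarrow> \<nexists>\<iota>. embedding \<phi> U (H \<circ> \<zeta>) \<iota>"
proof -
  obtain G0 where G0: "homeomorphism UNIV UNIV H0 G0" "H0 0 = 0" "G0 0 = 0" using Homeo0_E[OF H0(1)] by blast
  note h0 = homeomorphism_UNIV[OF G0(1)]
  have G0': "G0 \<in> Homeo0" "orient_pres G0"
    using G0 homeomorphism_symD[OF G0(1)] orient_pres_inverse[OF G0(1) H0(2)] unfolding Homeo0_def by auto
  have U0: "0 \<in> U" using U unfolding odisk_def PC_def by blast
  obtain g f where fg: "homeomorphism (ball (0::complex) 1) U f g"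
    using U homeomorphism_sym unfolding odisk_def homeomorphic_def by blast
  have f: "continuous_on (ball 0 1) f" "f ` ball 0 1 = U" "inj_on f (ball 0 1)"
    and g: "\<And>x. x \<in> U \<Longrightarrow> f (g x) = x" "g ` U = ball 0 1"
    using fg unfolding homeomorphism_def by (auto intro: inj_on_inverseI)
  have "local_homeo (H0 \<circ> \<psi>)"
    using pointed_lh_compose[OF H0 \<psi>] unfolding pointed_lh_def by blast
  with no obtain s where s: "norm (g 0) < s" "s < 1" and nos: "\<nexists>\<iota>. embedding \<phi> (f ` ball 0 s) (H0 \<circ> \<psi>) \<iota>"
    using embedding_exhaustion[OF _ fg U0] by blast
  have s0: "s > 0" using s(1) norm_ge_zero[of "g 0"] by linarith
  define V where "V = f ` ball 0 s"
  define C where "C = f ` cball 0 s"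
  have sub: "ball 0 s \<subseteq> ball (0::complex) 1" "cball 0 s \<subseteq> ball (0::complex) 1" using s(2) by auto
  have C: "compact C" "C \<subseteq> U" "V \<subseteq> C"
    using f(2) sub ball_subset_cball[of "0::complex" s] unfolding C_def V_def
    by (auto intro!: compact_continuous_image continuous_on_subset[OF f(1)])
  have V0: "0 \<in> V" using s(1) g(1)[OF U0] unfolding V_def by (metis imageI mem_ball_0)
  have cV: "continuous_on (ball 0 s) f" using f(1) sub(1) continuous_on_subset by blast
  have pc: "path_connected V"
    unfolding V_def by (intro path_connected_continuous_image cV convex_imp_path_connected convex_ball)
  obtain g' where "homeomorphism (ball 0 s) (f ` ball 0 s) f g'"
    by (rule invariance_of_domain_homeomorphism[OF open_ball cV _ inj_on_subset[OF f(3) sub(1)]]) auto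
  then have "ball (0::complex) s homeomorphic V"
    unfolding V_def homeomorphic_def by blast
  from homeomorphic_trans[OF this[unfolded homeomorphic_sym[of "ball 0 s"]] homeomorphic_balls(1)[OF s0 zero_less_one]]
  have V: "odisk V" using V0 pc unfolding odisk_def PC_def by blast
  \<comment> \<open>Moves \<open>H0\<close> to the other side: embedding \<open>V\<close>, developed
    by \<open>\<phi>'\<close>, in \<open>\<psi>\<close> amounts to embedding it, developed by
    \<open>\<phi>\<close>, in \<open>H0 \<circ> \<psi>\<close>.\<close>
  define \<phi>' where "\<phi>' = G0 \<circ> \<phi>"
  have \<phi>': "pointed_lh \<phi>'" unfolding \<phi>'_def by (rule pointed_lh_compose[OF G0' \<phi>])
  then have \<phi>'': "local_homeo \<phi>'" "\<phi>' 0 = 0" unfolding pointed_lh_def by auto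
  have H0\<phi>': "H0 (\<phi>' x) = \<phi> x" for x by (simp add: \<phi>'_def h0)
  have cont: "continuous_on A \<phi>'" for A
    using \<phi>''(1) continuous_on_subset unfolding local_homeo_iff by blast
  have "open U"
    using invariance_of_domain[OF f(1) open_ball f(3)] f(2) by simp
  \<comment> \<open>A Lebesgue number of the one-element cover of \<open>C\<close> by
    \<open>U\<close>: moving points of \<open>C\<close> by less than \<open>\<eta>\<close> keeps
    them in \<open>U\<close>.\<close>
  then obtain \<eta> where \<eta>: "\<eta> > 0" "\<And>p. p \<in> C \<Longrightarrow> ball p \<eta> \<subseteq> U"
    using Heine_Borel_lemma[OF C(1), of "{U}"] C(2) by auto
  obtain \<epsilon> where \<epsilon>: "\<epsilon> > 0" and lift:
    "\<And>G. continuous_on (\<phi>' ` C) G \<Longrightarrow> inj_on G (\<phi>' ` C) \<Longrightarrow>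
        \<forall>p\<in>C. dist (G (\<phi>' p)) (\<phi>' p) < \<epsilon> \<Longrightarrow>
        \<exists>T. continuous_on C T \<and> inj_on T C \<and>
          (\<forall>p\<in>C. dist (T p) p < \<eta> \<and> \<phi>' (T p) = G (\<phi>' p) \<and> (G (\<phi>' p) = \<phi>' p \<longrightarrow> T p = p))"
    by (rule local_homeo_lift_near_identity[OF \<phi>''(1) C(1) \<eta>(1)]) (rule that)
  have cC: "compact (\<phi>' ` C)" using C(1) cont by (intro compact_continuous_image)
  obtain N where N: "openin HomeoTop N" "H0 \<in> N" "\<And>H. H \<in> N \<Longrightarrow> H \<in> Homeo0"
    and near: "\<And>H x. H \<in> N \<Longrightarrow> x \<in> \<phi>' ` C \<Longrightarrow> dist (G0 (H x)) x < \<epsilon>"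
    by (rule HomeoTop_inverse_nbhd'[OF G0(1) H0(1) cC \<epsilon>]) (rule that)
  show ?thesis
  proof (rule that[OF N(1,2) \<phi>' V])
    show "\<nexists>\<iota>. embedding \<phi>' V \<psi> \<iota>"
    proof
      assume "\<exists>\<iota>. embedding \<phi>' V \<psi> \<iota>"
      then obtain \<iota> where "embedding \<phi>' V \<psi> \<iota>" by blast
      then have "embedding \<phi> V (H0 \<circ> \<psi>) \<iota>"
        unfolding embedding_def immersion_def using H0\<phi>' by auto
      with nos show False unfolding V_def by blast
    qed
    fix H \<zeta> assume H: "H \<in> N" and noV: "\<nexists>\<iota>. embedding \<phi>' V \<zeta> \<iota>"
    obtain G where G: "homeomorphism UNIV UNIV H G" "H 0 = 0" using Homeo0_E[OF N(3)[OF H]] by blast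
    note h = homeomorphism_UNIV[OF G(1)]
    show "\<nexists>\<iota>. embedding \<phi> U (H \<circ> \<zeta>) \<iota>"
    proof
      assume "\<exists>\<iota>. embedding \<phi> U (H \<circ> \<zeta>) \<iota>"
      then obtain \<iota> where i: "continuous_on U \<iota>" "\<iota> 0 = 0" "\<And>a. a \<in> U \<Longrightarrow> H (\<zeta> (\<iota> a)) = \<phi> a" "inj_on \<iota> U"
        unfolding embedding_def immersion_def by auto
      have "\<exists>T. continuous_on C T \<and> inj_on T C \<and>
          (\<forall>p\<in>C. dist (T p) p < \<eta> \<and> \<phi>' (T p) = (G0 \<circ> H) (\<phi>' p) \<and> ((G0 \<circ> H) (\<phi>' p) = \<phi>' p \<longrightarrow> T p = p))"
      proof (rule lift)
        show "continuous_on (\<phi>' ` C) (G0 \<circ> H)" by (intro continuous_on_compose h h0)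
        show "inj_on (G0 \<circ> H) (\<phi>' ` C)"
          using inj_compose[OF h0(4) h(3)] by (rule inj_on_subset) simp
      qed (use near[OF H] in auto)
      then obtain T where T: "continuous_on C T" "inj_on T C"
        "\<And>p. p \<in> C \<Longrightarrow> dist (T p) p < \<eta>" "\<And>p. p \<in> C \<Longrightarrow> \<phi>' (T p) = G0 (H (\<phi>' p))"
        "\<And>p. p \<in> C \<Longrightarrow> G0 (H (\<phi>' p)) = \<phi>' p \<Longrightarrow> T p = p" by auto
      have TU: "T p \<in> U" if "p \<in> C" for p
        using T(3)[OF that] \<eta>(2)[OF that] by (auto simp: dist_commute)
      have "embedding \<phi>' V \<zeta> (\<iota> \<circ> T)"
        unfolding embedding_def immersion_def
      proof (intro conjI ballI)
        show "continuous_on V (\<iota> \<circ> T)"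
          using C(3) TU by (intro continuous_on_compose continuous_on_subset[OF T(1)] continuous_on_subset[OF i(1)]) auto
        show "inj_on (\<iota> \<circ> T) V"
          using C(3) TU by (intro comp_inj_on inj_on_subset[OF T(2)] inj_on_subset[OF i(4)]) auto
        show "(\<iota> \<circ> T) 0 = 0"
          using T(5)[of 0] V0 C(3) \<phi>''(2) G0(3) G(2) i(2) by auto
        fix a assume "a \<in> V"
        then have a: "a \<in> C" using C(3) by blast
        \<comment> \<open>The developing maps are compared after applying \<open>H\<close>, where
          \<open>T\<close> turns \<open>H0 \<circ> \<phi>'\<close> into
          \<open>H \<circ> \<phi>'\<close>. The injective \<open>H\<close> is then
          cancelled.\<close>
        have "H (\<zeta> (\<iota> (T a))) = H0 (\<phi>' (T a))" using i(3)[OF TU[OF a]] H0\<phi>' by simp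
        also have "\<dots> = H (\<phi>' a)" using T(4)[OF a] h0(6) by simp
        finally show "\<zeta> ((\<iota> \<circ> T) a) = \<phi>' a" using h(3) by (simp add: inj_eq)
      qed
      with noV show False by blast
    qed
  qed
qed

subsection \<open>Continuity\<close>

lemma topspace_Mtop [simp]: "topspace Mtop = Mt"
  by (auto simp: Mtop_def topology_generated_by_topspace)

lemma topspace_Etop [simp]: "topspace Etop = Et"
  by (auto simp: Etop_def Eplus_def topology_generated_by_topspace)

lemma openin_Mtop_immersion:
  "pointed_lh \<phi> \<Longrightarrow> cdisk K \<Longrightarrow> openin Mtop {Q \<in> Mt. \<exists>\<psi>\<in>Q. \<exists>\<iota>. immersion \<phi> K \<psi> \<iota>}"
  unfolding Mtop_def by (intro topology_generated_by_Basis) blast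

lemma openin_Mtop_no_embedding:
  "pointed_lh \<phi> \<Longrightarrow> odisk U \<Longrightarrow> openin Mtop {Q \<in> Mt. \<not> (\<exists>\<psi>\<in>Q. \<exists>\<iota>. embedding \<phi> U \<psi> \<iota>)}"
  unfolding Mtop_def by (intro topology_generated_by_Basis) blast

lemma openin_Etop_Eplus:
  "pointed_lh \<phi> \<Longrightarrow> compact K \<Longrightarrow> PC K \<Longrightarrow> open U \<Longrightarrow> U \<subseteq> interior K \<Longrightarrow> openin Etop (Eplus \<phi> K U)"
  unfolding Etop_def by (intro topology_generated_by_Basis) blast

lemma piE_in_Mt: "E \<in> Et \<Longrightarrow> piE E \<in> Mt"
  by (metis Et_E Mclass_in_Mt piE_Ecl)

lemma continuous_map_piE: "continuous_map Etop Mtop piE"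
proof -
  have "openin Etop {E \<in> Et. piE E \<in> W}" if "openin Mtop W" for W
    using that unfolding Etop_def by (intro topology_generated_by_Basis) blast
  then show ?thesis
    by (auto simp: continuous_map_def piE_in_Mt)
qed

lemma continuous_map_into_Mtop:
  assumes "f \<in> topspace X \<rightarrow> Mt"
    and "\<And>\<phi> K. pointed_lh \<phi> \<Longrightarrow> cdisk K \<Longrightarrow>
      openin X {x \<in> topspace X. \<exists>\<psi>\<in>f x. \<exists>\<iota>. immersion \<phi> K \<psi> \<iota>}"
    and "\<And>\<phi> U. pointed_lh \<phi> \<Longrightarrow> odisk U \<Longrightarrow>
      openin X {x \<in> topspace X. \<not> (\<exists>\<psi>\<in>f x. \<exists>\<iota>. embedding \<phi> U \<psi> \<iota>)}"
  shows "continuous_map X Mtop f"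
  unfolding Mtop_def
proof (rule continuous_on_generated_topo)
  fix W assume "W \<in> {Mt} \<union> {{Q \<in> Mt. \<exists>\<psi>\<in>Q. \<exists>\<iota>. immersion \<phi> K \<psi> \<iota>} | \<phi> K. pointed_lh \<phi> \<and> cdisk K}
      \<union> {{Q \<in> Mt. \<not> (\<exists>\<psi>\<in>Q. \<exists>\<iota>. embedding \<phi> U \<psi> \<iota>)} | \<phi> U. pointed_lh \<phi> \<and> odisk U}"
  then consider "W = Mt"
    | \<phi> K where "pointed_lh \<phi>" "cdisk K" "W = {Q \<in> Mt. \<exists>\<psi>\<in>Q. \<exists>\<iota>. immersion \<phi> K \<psi> \<iota>}"
    | \<phi> U where "pointed_lh \<phi>" "odisk U" "W = {Q \<in> Mt. \<not> (\<exists>\<psi>\<in>Q. \<exists>\<iota>. embedding \<phi> U \<psi> \<iota>)}"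
    by blast
  then show "openin X (f -` W \<inter> topspace X)"
  proof cases
    case 1
    then have "f -` W \<inter> topspace X = topspace X" using assms(1) by auto
    then show ?thesis by simp
  next
    case 2
    then have "f -` W \<inter> topspace X = {x \<in> topspace X. \<exists>\<psi>\<in>f x. \<exists>\<iota>. immersion \<phi> K \<psi> \<iota>}"
      using assms(1) by auto
    then show ?thesis using assms(2)[OF 2(1,2)] by simp
  next
    case 3
    then have "f -` W \<inter> topspace X = {x \<in> topspace X. \<not> (\<exists>\<psi>\<in>f x. \<exists>\<iota>. embedding \<phi> U \<psi> \<iota>)}"
      using assms(1) by auto
    then show ?thesis using assms(3)[OF 3(1,2)] by simp
  qed
qed (use assms(1) in auto)

lemma continuous_map_into_Etop:
  assumes "f \<in> topspace X \<rightarrow> Et" and "continuous_map X Mtop (\<lambda>x. piE (f x))"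
    and "\<And>\<phi> K U. pointed_lh \<phi> \<Longrightarrow> compact K \<Longrightarrow> PC K \<Longrightarrow> open U \<Longrightarrow> U \<subseteq> interior K \<Longrightarrow>
      openin X {x \<in> topspace X. f x \<in> Eplus \<phi> K U}"
  shows "continuous_map X Etop f"
  unfolding Etop_def
proof (rule continuous_on_generated_topo)
  fix W assume "W \<in> {Et} \<union> {{E \<in> Et. piE E \<in> W} | W. openin Mtop W}
      \<union> {Eplus \<phi> K U | \<phi> K U. pointed_lh \<phi> \<and> compact K \<and> PC K \<and> open U \<and> U \<subseteq> interior K}"
  then consider "W = Et" | V where "openin Mtop V" "W = {E \<in> Et. piE E \<in> V}"
    | \<phi> K U where "pointed_lh \<phi>" "compact K" "PC K" "open U" "U \<subseteq> interior K" "W = Eplus \<phi> K U"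
    by blast
  then show "openin X (f -` W \<inter> topspace X)"
  proof cases
    case 1
    then have "f -` W \<inter> topspace X = topspace X" using assms(1) by auto
    then show ?thesis by simp
  next
    case 2
    then have "f -` W \<inter> topspace X = {x \<in> topspace X. piE (f x) \<in> V}"
      using assms(1) by auto
    then show ?thesis using openin_continuous_map_preimage[OF assms(2) 2(1)] by simp
  next
    case 3
    then have "f -` W \<inter> topspace X = {x \<in> topspace X. f x \<in> Eplus \<phi> K U}" by auto
    then show ?thesis using assms(3)[OF 3(1-5)] by simp
  qed
qed (use assms(1) in auto)

section \<open>Continuity of the reflection on the moduli spaces\<close>

lemma cdisk_cball: "R > 0 \<Longrightarrow> cdisk (cball 0 R)"
  unfolding cdisk_def PC_def
  by (auto intro!: convex_imp_path_connected homeomorphic_balls(2))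

lemma homeomorphic_cnj_image: "cnj ` S homeomorphic T" if "S homeomorphic T"
proof -
  have "homeomorphism (cnj ` S) S cnj cnj"
    by (rule homeomorphismI) auto
  then show ?thesis using that homeomorphic_trans unfolding homeomorphic_def by blast
qed

lemma interior_cnj_image: "interior (cnj ` S) = cnj ` interior S"
  by (rule interior_injective_linear_image) (auto intro: bounded_linear.linear bounded_linear_cnj)

lemma PC_cnj_image: "PC S \<Longrightarrow> PC (cnj ` S)"
  unfolding PC_def by (auto intro!: path_connected_continuous_image image_eqI[of 0 cnj 0])

lemma cdisk_cnj_image: "cdisk K \<Longrightarrow> cdisk (cnj ` K)"
  unfolding cdisk_def
  by (auto simp: interior_cnj_image PC_cnj_image homeomorphic_cnj_image intro!: image_eqI[of 0 cnj 0])

lemma odisk_cnj_image: "odisk U \<Longrightarrow> odisk (cnj ` U)"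
  unfolding odisk_def by (auto simp: PC_cnj_image homeomorphic_cnj_image)


lemma conjM_ex_immersion:
  assumes "Q \<in> Mt"
  shows "(\<exists>\<zeta>\<in>conjM Q. \<exists>\<iota>. immersion \<phi> K \<zeta> \<iota>) \<longleftrightarrow>
    (\<exists>\<zeta>\<in>Q. \<exists>\<iota>. immersion (cnj \<circ> \<phi> \<circ> cnj) (cnj ` K) \<zeta> \<iota>)"
proof -
  obtain \<psi> where \<psi>: "pointed_lh \<psi>" "Q = Mclass \<psi>" using assms by (rule Mt_E)
  show ?thesis
    using immersion_cnj_conj[of \<phi> K "cnj \<circ> \<psi> \<circ> cnj"]
    unfolding \<psi>(2) conjM_Mclass[OF \<psi>(1)] Mclass_immersion_iff[OF \<psi>(1)]
      Mclass_immersion_iff[OF pointed_lh_cnj_conj[OF \<psi>(1)]]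
    by (metis cnj_conj_involutive)
qed

lemma conjM_ex_embedding:
  assumes "Q \<in> Mt"
  shows "(\<exists>\<zeta>\<in>conjM Q. \<exists>\<iota>. embedding \<phi> K \<zeta> \<iota>) \<longleftrightarrow>
    (\<exists>\<zeta>\<in>Q. \<exists>\<iota>. embedding (cnj \<circ> \<phi> \<circ> cnj) (cnj ` K) \<zeta> \<iota>)"
proof -
  obtain \<psi> where \<psi>: "pointed_lh \<psi>" "Q = Mclass \<psi>" using assms by (rule Mt_E)
  show ?thesis
    using embedding_cnj_conj[of \<phi> K "cnj \<circ> \<psi> \<circ> cnj"]
    unfolding \<psi>(2) conjM_Mclass[OF \<psi>(1)] Mclass_embedding_iff[OF \<psi>(1)]
      Mclass_embedding_iff[OF pointed_lh_cnj_conj[OF \<psi>(1)]]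
    by (metis cnj_conj_involutive)
qed

lemma conjE_in_Eplus_iff:
  assumes "pointed_lh \<psi>"
  shows "conjE (Ecl \<psi> y) \<in> Eplus \<phi> K U \<longleftrightarrow> Ecl \<psi> y \<in> Eplus (cnj \<circ> \<phi> \<circ> cnj) (cnj ` K) (cnj ` U)"
proof -
  have *: "cnj y \<in> \<iota> ` U \<longleftrightarrow> y \<in> (cnj \<circ> \<iota> \<circ> cnj) ` (cnj ` U)" for \<iota>
    by (auto simp: image_comp comp_def image_iff) (metis complex_cnj_cnj)
  show ?thesis
    unfolding conjE_Ecl[OF assms] Ecl_in_Eplus_iff[OF assms] Ecl_in_Eplus_iff[OF pointed_lh_cnj_conj[OF assms]]
  proof
    assume "\<exists>\<iota>. immersion \<phi> K (cnj \<circ> \<psi> \<circ> cnj) \<iota> \<and> cnj y \<in> \<iota> ` U"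
    then obtain \<iota> where i: "immersion \<phi> K (cnj \<circ> \<psi> \<circ> cnj) \<iota>" "cnj y \<in> \<iota> ` U" by blast
    have "immersion (cnj \<circ> \<phi> \<circ> cnj) (cnj ` K) \<psi> (cnj \<circ> \<iota> \<circ> cnj)"
      using i(1) immersion_cnj_conj[of \<phi> K "cnj \<circ> \<psi> \<circ> cnj" \<iota>] by simp
    with i(2) * show "\<exists>\<iota>. immersion (cnj \<circ> \<phi> \<circ> cnj) (cnj ` K) \<psi> \<iota> \<and> y \<in> \<iota> ` cnj ` U" by blast
  next
    assume "\<exists>\<iota>. immersion (cnj \<circ> \<phi> \<circ> cnj) (cnj ` K) \<psi> \<iota> \<and> y \<in> \<iota> ` cnj ` U"
    then obtain \<iota> where i: "immersion (cnj \<circ> \<phi> \<circ> cnj) (cnj ` K) \<psi> \<iota>" "y \<in> \<iota> ` cnj ` U" by blast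
    have "immersion \<phi> K (cnj \<circ> \<psi> \<circ> cnj) (cnj \<circ> \<iota> \<circ> cnj)"
      using i(1) immersion_cnj_conj[of \<phi> K "cnj \<circ> \<psi> \<circ> cnj" "cnj \<circ> \<iota> \<circ> cnj"] by simp
    moreover have "cnj y \<in> (cnj \<circ> \<iota> \<circ> cnj) ` U"
      using i(2) *[of "cnj \<circ> \<iota> \<circ> cnj"] by simp
    ultimately show "\<exists>\<iota>. immersion \<phi> K (cnj \<circ> \<psi> \<circ> cnj) \<iota> \<and> cnj y \<in> \<iota> ` U" by blast
  qed
qed

lemma conjM_in_Mt: "P \<in> Mt \<Longrightarrow> conjM P \<in> Mt"
  by (elim Mt_E) (simp add: conjM_Mclass Mclass_in_Mt pointed_lh_cnj_conj)

lemma conjE_in_Et: "E \<in> Et \<Longrightarrow> conjE E \<in> Et"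
  by (elim Et_E) (simp add: conjE_Ecl Ecl_in_Et pointed_lh_cnj_conj)

text \<open>The preimage of a subbasic set is the subbasic set of the same kind for the mirrored
  disk and the conjugated developing map.\<close>

lemma continuous_map_conjM: "continuous_map Mtop Mtop conjM"
proof (rule continuous_map_into_Mtop)
  fix \<phi> K assume \<phi>: "pointed_lh \<phi>"
  have "{Q \<in> topspace Mtop. \<exists>\<psi>\<in>conjM Q. \<exists>\<iota>. immersion \<phi> K \<psi> \<iota>} =
      {Q \<in> Mt. \<exists>\<psi>\<in>Q. \<exists>\<iota>. immersion (cnj \<circ> \<phi> \<circ> cnj) (cnj ` K) \<psi> \<iota>}"
    by (simp add: conjM_ex_immersion cong: conj_cong)
  then show "openin Mtop {Q \<in> topspace Mtop. \<exists>\<psi>\<in>conjM Q. \<exists>\<iota>. immersion \<phi> K \<psi> \<iota>}" if "cdisk K"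
    using openin_Mtop_immersion[OF pointed_lh_cnj_conj[OF \<phi>] cdisk_cnj_image[OF that]] by simp
  have "{Q \<in> topspace Mtop. \<not> (\<exists>\<psi>\<in>conjM Q. \<exists>\<iota>. embedding \<phi> K \<psi> \<iota>)} =
      {Q \<in> Mt. \<not> (\<exists>\<psi>\<in>Q. \<exists>\<iota>. embedding (cnj \<circ> \<phi> \<circ> cnj) (cnj ` K) \<psi> \<iota>)}"
    by (simp add: conjM_ex_embedding cong: conj_cong)
  then show "openin Mtop {Q \<in> topspace Mtop. \<not> (\<exists>\<psi>\<in>conjM Q. \<exists>\<iota>. embedding \<phi> K \<psi> \<iota>)}" if "odisk K"
    using openin_Mtop_no_embedding[OF pointed_lh_cnj_conj[OF \<phi>] odisk_cnj_image[OF that]] by simp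
qed (simp add: conjM_in_Mt)

lemma continuous_map_conjE: "continuous_map Etop Etop conjE"
proof (rule continuous_map_into_Etop)
  show "continuous_map Etop Mtop (\<lambda>E. piE (conjE E))"
    unfolding piE_conjE using continuous_map_compose[OF continuous_map_piE continuous_map_conjM]
    by (simp add: comp_def)
  fix \<phi> K U assume a: "pointed_lh \<phi>" "compact K" "PC K" "open U" "U \<subseteq> interior K"
  have "{E \<in> topspace Etop. conjE E \<in> Eplus \<phi> K U} = Eplus (cnj \<circ> \<phi> \<circ> cnj) (cnj ` K) (cnj ` U)" (is "?L = ?R")
  proof -
    have "E \<in> ?L \<longleftrightarrow> E \<in> ?R" if E: "E \<in> Et" for E
    proof -
      obtain \<psi> y where "pointed_lh \<psi>" "E = Ecl \<psi> y" using E by (rule Et_E)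
      with E show ?thesis by (simp add: conjE_in_Eplus_iff)
    qed
    moreover have "?L \<subseteq> Et" "?R \<subseteq> Et" unfolding Eplus_def by auto
    ultimately show ?thesis by blast
  qed
  moreover have "open (cnj ` U)"
    using local_homeo_open_map[OF local_homeo_homeomorphism[OF homeomorphism_cnj] a(4)] .
  moreover have "cnj ` U \<subseteq> interior (cnj ` K)" using a(5) by (auto simp: interior_cnj_image)
  moreover have "compact (cnj ` K)" using a(2) by (intro compact_continuous_image) auto
  ultimately show "openin Etop {E \<in> topspace Etop. conjE E \<in> Eplus \<phi> K U}"
    using openin_Etop_Eplus[OF pointed_lh_cnj_conj[OF a(1)] _ PC_cnj_image[OF a(3)]] by simp
qed (simp add: conjE_in_Et)

section \<open>Joint continuity for orientation-preserving homeomorphisms\<close>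

abbreviation "HomeoTop_op \<equiv> subtopology HomeoTop {H \<in> Homeo0. orient_pres H}"

text \<open>It suffices to find product neighbourhoods. The first factor may be taken open among all
  homeomorphisms and is cut down to the orientation-preserving ones afterwards.\<close>

lemma openin_prod_HomeoTop_op:
  assumes "\<And>H0 x0. H0 \<in> Homeo0 \<Longrightarrow> orient_pres H0 \<Longrightarrow> x0 \<in> topspace X \<Longrightarrow> \<Phi> H0 x0 \<Longrightarrow>
    \<exists>N B. openin HomeoTop N \<and> openin X B \<and> H0 \<in> N \<and> x0 \<in> B \<and>
      (\<forall>H x. H \<in> N \<and> H \<in> Homeo0 \<and> orient_pres H \<and> x \<in> B \<longrightarrow> \<Phi> H x)"
  shows "openin (prod_topology HomeoTop_op X) {z \<in> topspace (prod_topology HomeoTop_op X). \<Phi> (fst z) (snd z)}"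
  unfolding openin_prod_topology_alt
proof (intro allI impI)
  fix H0 x0 assume "(H0, x0) \<in> {z \<in> topspace (prod_topology HomeoTop_op X). \<Phi> (fst z) (snd z)}"
  then have a: "H0 \<in> Homeo0" "orient_pres H0" "x0 \<in> topspace X" "\<Phi> H0 x0" by auto
  obtain N B where N: "openin HomeoTop N" "openin X B" "H0 \<in> N" "x0 \<in> B"
    and \<Phi>: "\<forall>H x. H \<in> N \<and> H \<in> Homeo0 \<and> orient_pres H \<and> x \<in> B \<longrightarrow> \<Phi> H x"
    using assms[OF a] by (elim exE conjE) (rule that)
  let ?A = "N \<inter> {H \<in> Homeo0. orient_pres H}"
  have "openin HomeoTop_op ?A" using N(1) by (rule openin_subtopology_Int)
  moreover have "?A \<times> B \<subseteq> {z \<in> topspace (prod_topology HomeoTop_op X). \<Phi> (fst z) (snd z)}"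
    using \<Phi> openin_subset[OF N(2)] by auto
  moreover have "H0 \<in> ?A" using N(3) a by simp
  ultimately show "\<exists>U V. openin HomeoTop_op U \<and> openin X V \<and> H0 \<in> U \<and> x0 \<in> V \<and>
      U \<times> V \<subseteq> {z \<in> topspace (prod_topology HomeoTop_op X). \<Phi> (fst z) (snd z)}"
    using N(2,4) by (intro exI conjI)
qed

lemma actM_in_Mt: "H \<in> Homeo0 \<Longrightarrow> orient_pres H \<Longrightarrow> P \<in> Mt \<Longrightarrow> actM H P \<in> Mt"
  by (elim Mt_E) (simp add: actM_Mclass Mclass_in_Mt pointed_lh_compose)

lemma actE_in_Et: "H \<in> Homeo0 \<Longrightarrow> orient_pres H \<Longrightarrow> E \<in> Et \<Longrightarrow> actE H E \<in> Et"
  by (elim Et_E) (simp add: actE_Ecl Ecl_in_Et pointed_lh_compose)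

lemma continuous_map_actM_op: "continuous_map (prod_topology HomeoTop_op Mtop) Mtop (\<lambda>(H, P). actM H P)"
proof (rule continuous_map_into_Mtop, unfold case_prod_unfold)
  fix \<phi> K assume \<phi>: "pointed_lh \<phi>" and K: "cdisk K"
  show "openin (prod_topology HomeoTop_op Mtop)
      {x \<in> topspace (prod_topology HomeoTop_op Mtop). \<exists>\<psi>\<in>actM (fst x) (snd x). \<exists>\<iota>. immersion \<phi> K \<psi> \<iota>}"
  proof (rule openin_prod_HomeoTop_op)
    fix H0 P0
    assume H0: "H0 \<in> Homeo0" "orient_pres H0" and P0: "P0 \<in> topspace Mtop"
      and ex: "\<exists>\<psi>\<in>actM H0 P0. \<exists>\<iota>. immersion \<phi> K \<psi> \<iota>"
    obtain \<psi> where \<psi>: "pointed_lh \<psi>" "P0 = Mclass \<psi>" using P0 Mt_E by auto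
    obtain \<iota> where i: "immersion \<phi> K (H0 \<circ> \<psi>) \<iota>"
      using ex unfolding \<psi>(2) actM_Mclass[OF H0 \<psi>(1)] Mclass_immersion_iff[OF pointed_lh_compose[OF H0 \<psi>(1)]] by blast
    have cK: "compact K" "0 \<in> K" "0 \<in> interior K"
      using K homeomorphic_compactness[of K "cball (0::complex) 1"] unfolding cdisk_def PC_def by auto
    \<comment> \<open>The choice \<open>u = 0\<close>, \<open>U = interior K\<close> is admissible
      because a closed disk in the subbasis has the basepoint in its interior.\<close>
    obtain N R V where N: "openin HomeoTop N" "H0 \<in> N" "R > 0"
      "open V" "V \<subseteq> ball 0 R" "\<iota> 0 \<in> V"
      and ext: "\<And>H \<zeta> \<kappa>. H \<in> N \<Longrightarrow> immersion \<psi> (cball 0 R) \<zeta> \<kappa> \<Longrightarrow>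
         \<exists>\<kappa>'. immersion \<phi> K (H \<circ> \<zeta>) \<kappa>' \<and> \<kappa> ` V \<subseteq> \<kappa>' ` interior K"
      by (rule immersion_nearby[OF H0(1) \<phi> \<psi>(1) cK(1,2) open_interior interior_subset cK(3) i]) (rule that)
    let ?B = "{Q \<in> Mt. \<exists>\<zeta>\<in>Q. \<exists>\<iota>. immersion \<psi> (cball 0 R) \<zeta> \<iota>}"
    \<comment> \<open>The inclusion of a disk in its own surface puts \<open>P0\<close> into the
      neighbourhood \<open>?B\<close>.\<close>
    have "immersion \<psi> (cball 0 R) \<psi> (\<lambda>x. x)" by (simp add: immersion_def)
    then have P0B: "P0 \<in> ?B" using P0 self_in_Mclass[OF \<psi>(1)] \<psi>(2) by auto
    have "\<exists>\<zeta>\<in>actM H Q. \<exists>\<iota>. immersion \<phi> K \<zeta> \<iota>"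
      if H: "H \<in> N" "H \<in> Homeo0" "orient_pres H" and Q: "Q \<in> ?B" for H Q
    proof -
      obtain \<zeta> where z: "pointed_lh \<zeta>" "Q = Mclass \<zeta>" using Q by (blast elim: Mt_E)
      obtain \<kappa> where "immersion \<psi> (cball 0 R) \<zeta> \<kappa>"
        using Q unfolding z(2) by (auto simp: Mclass_immersion_iff[OF z(1)])
      then have "\<exists>\<kappa>'. immersion \<phi> K (H \<circ> \<zeta>) \<kappa>'" using ext H(1) by blast
      then show ?thesis
        using H z by (simp add: actM_Mclass Mclass_immersion_iff pointed_lh_compose)
    qed
    with N(1,2) P0B openin_Mtop_immersion[OF \<psi>(1) cdisk_cball[OF N(3)]]
    show "\<exists>N B. openin HomeoTop N \<and> openin Mtop B \<and> H0 \<in> N \<and> P0 \<in> B \<and>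
      (\<forall>H Q. H \<in> N \<and> H \<in> Homeo0 \<and> orient_pres H \<and> Q \<in> B \<longrightarrow>
        (\<exists>\<psi>\<in>actM H Q. \<exists>\<iota>. immersion \<phi> K \<psi> \<iota>))"
      by (intro exI[of _ N] exI[of _ ?B]) blast
  qed
next
  fix \<phi> U assume \<phi>: "pointed_lh \<phi>" and U: "odisk U"
  show "openin (prod_topology HomeoTop_op Mtop)
      {x \<in> topspace (prod_topology HomeoTop_op Mtop). \<not> (\<exists>\<psi>\<in>actM (fst x) (snd x). \<exists>\<iota>. embedding \<phi> U \<psi> \<iota>)}"
  proof (rule openin_prod_HomeoTop_op)
    fix H0 P0
    assume H0: "H0 \<in> Homeo0" "orient_pres H0" and P0: "P0 \<in> topspace Mtop"
      and no: "\<not> (\<exists>\<psi>\<in>actM H0 P0. \<exists>\<iota>. embedding \<phi> U \<psi> \<iota>)"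
    obtain \<psi> where \<psi>: "pointed_lh \<psi>" "P0 = Mclass \<psi>" using P0 Mt_E by auto
    have no': "\<nexists>\<iota>. embedding \<phi> U (H0 \<circ> \<psi>) \<iota>"
      using no unfolding \<psi>(2) actM_Mclass[OF H0 \<psi>(1)] Mclass_embedding_iff[OF pointed_lh_compose[OF H0 \<psi>(1)]] .
    obtain N \<phi>' V where N: "openin HomeoTop N" "H0 \<in> N" "pointed_lh \<phi>'" "odisk V"
      "\<nexists>\<iota>. embedding \<phi>' V \<psi> \<iota>"
      and ext: "\<And>H \<zeta>. H \<in> N \<Longrightarrow> \<nexists>\<iota>. embedding \<phi>' V \<zeta> \<iota> \<Longrightarrow> \<nexists>\<iota>. embedding \<phi> U (H \<circ> \<zeta>) \<iota>"
      by (rule no_embedding_nearby[OF H0 \<phi> \<psi>(1) U no']) (rule that)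
    let ?B = "{Q \<in> Mt. \<not> (\<exists>\<zeta>\<in>Q. \<exists>\<iota>. embedding \<phi>' V \<zeta> \<iota>)}"
    have P0B: "P0 \<in> ?B" using P0 N(5) Mclass_embedding_iff[OF \<psi>(1), of \<phi>' V] unfolding \<psi>(2) by auto
    have "\<not> (\<exists>\<zeta>\<in>actM H Q. \<exists>\<iota>. embedding \<phi> U \<zeta> \<iota>)"
      if H: "H \<in> N" "H \<in> Homeo0" "orient_pres H" and Q: "Q \<in> ?B" for H Q
    proof -
      obtain \<zeta> where z: "pointed_lh \<zeta>" "Q = Mclass \<zeta>" using Q by (blast elim: Mt_E)
      have "\<nexists>\<iota>. embedding \<phi>' V \<zeta> \<iota>"
        using Q Mclass_embedding_iff[OF z(1), of \<phi>' V] unfolding z(2) by auto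
      from ext[OF H(1) this] show ?thesis
        unfolding z(2) actM_Mclass[OF H(2,3) z(1)]
          Mclass_embedding_iff[OF pointed_lh_compose[OF H(2,3) z(1)]] .
    qed
    with N(1,2) P0B openin_Mtop_no_embedding[OF N(3,4)]
    show "\<exists>N B. openin HomeoTop N \<and> openin Mtop B \<and> H0 \<in> N \<and> P0 \<in> B \<and>
      (\<forall>H Q. H \<in> N \<and> H \<in> Homeo0 \<and> orient_pres H \<and> Q \<in> B \<longrightarrow>
        \<not> (\<exists>\<psi>\<in>actM H Q. \<exists>\<iota>. embedding \<phi> U \<psi> \<iota>))"
      by (intro exI[of _ N] exI[of _ ?B]) blast
  qed
qed (auto simp: actM_in_Mt)

lemma continuous_map_actE_op: "continuous_map (prod_topology HomeoTop_op Etop) Etop (\<lambda>(H, E). actE H E)"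
proof (rule continuous_map_into_Etop, unfold case_prod_unfold)
  \<comment> \<open>The projection \<open>piE\<close> is equivariant, so the condition on the
    underlying surface reduces to continuity on \<open>Mt\<close>.\<close>
  have "continuous_map (prod_topology HomeoTop_op Etop) (prod_topology HomeoTop_op Mtop) (\<lambda>x. (fst x, piE (snd x)))"
    by (intro continuous_map_pairedI continuous_map_fst continuous_map_compose[OF continuous_map_snd continuous_map_piE, unfolded comp_def])
  from continuous_map_compose[OF this continuous_map_actM_op]
  show "continuous_map (prod_topology HomeoTop_op Etop) Mtop (\<lambda>x. piE (actE (fst x) (snd x)))"
    by (simp add: comp_def case_prod_unfold piE_actE)
  fix \<phi> K U assume \<phi>: "pointed_lh \<phi>" and K: "compact K" "PC K" and U: "open U" "U \<subseteq> interior K"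
  have K0: "0 \<in> K" "U \<subseteq> K" using K(2) U(2) interior_subset[of K] unfolding PC_def by auto
  show "openin (prod_topology HomeoTop_op Etop)
      {x \<in> topspace (prod_topology HomeoTop_op Etop). actE (fst x) (snd x) \<in> Eplus \<phi> K U}"
  proof (rule openin_prod_HomeoTop_op)
    fix H0 E0
    assume H0: "H0 \<in> Homeo0" "orient_pres H0" and E0: "E0 \<in> topspace Etop"
      and mem: "actE H0 E0 \<in> Eplus \<phi> K U"
    obtain \<psi> y where \<psi>: "pointed_lh \<psi>" "E0 = Ecl \<psi> y" using E0 Et_E by auto
    obtain \<iota> u where i: "immersion \<phi> K (H0 \<circ> \<psi>) \<iota>" "u \<in> U" "y = \<iota> u"
      using mem unfolding \<psi>(2) actE_Ecl[OF H0 \<psi>(1)] Ecl_in_Eplus_iff[OF pointed_lh_compose[OF H0 \<psi>(1)]] by blast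
    obtain N R V where N: "openin HomeoTop N" "H0 \<in> N" "R > 0" "open V" "V \<subseteq> ball 0 R" "\<iota> u \<in> V"
      and ext: "\<And>H \<zeta> \<kappa>. H \<in> N \<Longrightarrow> immersion \<psi> (cball 0 R) \<zeta> \<kappa> \<Longrightarrow>
         \<exists>\<kappa>'. immersion \<phi> K (H \<circ> \<zeta>) \<kappa>' \<and> \<kappa> ` V \<subseteq> \<kappa>' ` U"
      by (rule immersion_nearby[OF H0(1) \<phi> \<psi>(1) K(1) K0(1) U(1) K0(2) i(2,1)]) (rule that)
    \<comment> \<open>One subbasic set controls both: \<open>E\<close> carries an immersed large
      disk of \<open>\<psi>\<close>, and its marked point lies in the image of
      \<open>V\<close>.\<close>
    let ?B = "Eplus \<psi> (cball 0 R) V"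
    have "immersion \<psi> (cball 0 R) \<psi> (\<lambda>x. x)" "y \<in> (\<lambda>x. x) ` V"
      using N(6) i(3) by (simp_all add: immersion_def)
    then have E0B: "E0 \<in> ?B" unfolding \<psi>(2) Ecl_in_Eplus_iff[OF \<psi>(1)] by blast
    have B: "openin Etop ?B"
      using cdisk_cball[OF N(3)] N(4,5) by (intro openin_Etop_Eplus \<psi>(1)) (auto simp: cdisk_def)
    have "actE H E \<in> Eplus \<phi> K U"
      if H: "H \<in> N" "H \<in> Homeo0" "orient_pres H" and E: "E \<in> ?B" for H E
    proof -
      have "E \<in> Et" using E unfolding Eplus_def by blast
      then obtain \<zeta> z where z: "pointed_lh \<zeta>" "E = Ecl \<zeta> z" by (rule Et_E)
      obtain \<kappa> where \<kappa>: "immersion \<psi> (cball 0 R) \<zeta> \<kappa>" "z \<in> \<kappa> ` V"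
        using E unfolding z(2) Ecl_in_Eplus_iff[OF z(1)] by blast
      then have "\<exists>\<kappa>'. immersion \<phi> K (H \<circ> \<zeta>) \<kappa>' \<and> z \<in> \<kappa>' ` U"
        using ext[OF H(1) \<kappa>(1)] by blast
      then show ?thesis
        using H z by (simp add: actE_Ecl Ecl_in_Eplus_iff pointed_lh_compose)
    qed
    with N(1,2) E0B B
    show "\<exists>N B. openin HomeoTop N \<and> openin Etop B \<and> H0 \<in> N \<and> E0 \<in> B \<and>
      (\<forall>H E. H \<in> N \<and> H \<in> Homeo0 \<and> orient_pres H \<and> E \<in> B \<longrightarrow> actE H E \<in> Eplus \<phi> K U)"
      by (intro exI[of _ N] exI[of _ ?B]) blast
  qed
qed (auto simp: actE_in_Et)

text \<open>Paste over the open cover by the two orientation classes. On the reversing class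
  \<open>F\<close> factors through \<open>(H, x) \<mapsto> (H \<circ> cnj, C x)\<close>, which is
  continuous with values in the preserving part.\<close>

lemma continuous_map_HomeoTop_extend:
  assumes op: "continuous_map (prod_topology HomeoTop_op X) Y F"
    and C: "continuous_map X X C"
    and eq: "\<And>H x. H \<in> Homeo0 \<Longrightarrow> \<not> orient_pres H \<Longrightarrow> x \<in> topspace X \<Longrightarrow> F (H, x) = F (H \<circ> cnj, C x)"
  shows "continuous_map (prod_topology HomeoTop X) Y F"
proof (rule pasting_lemma[where I = UNIV and T = "\<lambda>b. {H \<in> Homeo0. orient_pres H = b} \<times> topspace X" and f = "\<lambda>b. F"])
  fix b :: bool
  show "openin (prod_topology HomeoTop X) ({H \<in> Homeo0. orient_pres H = b} \<times> topspace X)"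
    by (simp add: openin_prod_Times_iff openin_orient_pres_eq)
  have sub: "subtopology (prod_topology HomeoTop X) (A \<times> topspace X) = prod_topology (subtopology HomeoTop A) X" for A
    by (simp add: subtopology_Times)
  let ?R = "subtopology HomeoTop {H \<in> Homeo0. \<not> orient_pres H}"
  have "orient_pres (H \<circ> cnj)" if H: "H \<in> Homeo0" "\<not> orient_pres H" for H
  proof -
    obtain G where "homeomorphism UNIV UNIV H G" using Homeo0_E[OF H(1)] by blast
    from orient_pres_compose_cnj[OF this H(2)] show ?thesis .
  qed
  then have "continuous_map ?R HomeoTop_op (\<lambda>H. H \<circ> cnj)"
    using Homeo0_compose_cnj
    by (intro continuous_map_into_subtopology continuous_map_from_subtopology continuous_map_compose_cnj) auto
  from continuous_map_compose[OF continuous_map_fst this]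
  have "continuous_map (prod_topology ?R X) HomeoTop_op (\<lambda>x. fst x \<circ> cnj)"
    by (simp add: comp_def)
  moreover have "continuous_map (prod_topology ?R X) X (\<lambda>x. C (snd x))"
    using continuous_map_compose[OF continuous_map_snd C] by (simp add: comp_def)
  ultimately have "continuous_map (prod_topology ?R X) (prod_topology HomeoTop_op X) (\<lambda>x. (fst x \<circ> cnj, C (snd x)))"
    by (intro continuous_map_pairedI)
  from continuous_map_compose[OF this op]
  have "continuous_map (prod_topology ?R X) Y F"
    by (rule continuous_map_eq) (auto simp: eq)
  with op show "continuous_map (subtopology (prod_topology HomeoTop X) ({H \<in> Homeo0. orient_pres H = b} \<times> topspace X)) Y F"
    unfolding sub by (cases b) simp_all
qed auto

theorem mainTheorem12:
  shows "continuous_map (prod_topology HomeoTop Mtop) Mtop (\<lambda>(H, P). actM H P)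
       \<and> continuous_map (prod_topology HomeoTop Etop) Etop (\<lambda>(H, E). actE H E)"
proof
  show "continuous_map (prod_topology HomeoTop Mtop) Mtop (\<lambda>(H, P). actM H P)"
    by (rule continuous_map_HomeoTop_extend[OF continuous_map_actM_op continuous_map_conjM])
       (simp add: act_reversing(2))
  show "continuous_map (prod_topology HomeoTop Etop) Etop (\<lambda>(H, E). actE H E)"
    by (rule continuous_map_HomeoTop_extend[OF continuous_map_actE_op continuous_map_conjE])
       (simp add: act_reversing(1))
qed


end
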